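(* Let $M$ be a rotational hypersurface of type I in $\mathbb C^n\times\mathbb R$ ($\dim M=2n\ge 4$). Then the Kähler structure $(g,J)$ on $M$ is Bochner-Kähler if and only if $$s(t)=\int\frac{dt}{c_1t^4+c_2t^2+1},$$ where $c_1=\mathrm{const}$, $c_2=\mathrm{const}$ (i.e. there are real constants $c_1,c_2$ such that the inverse function $s(t)$ of $t(s)$ is an antiderivative of $1/(c_1t^4+c_2t^2+1)$).
   Context: Rotational hypersurfaces of type I: let $(\mathbb C^n,g',J_0)$ be the complex Euclidean space with standard complex structure $J_0$ and let $\mathbb R$ be spanned by a unit vector $\mathbf e$, $\mathbf e^2=+1$, with the Euclidean product metric on $\mathbb C^n\times\mathbb R=\mathbb R^{2n+1}$. For smooth functions $t(s)>0$, $q(s)$ on an interval $I$ with $t'^2+q'^2=1$ ($s$ is a natural parameter of the meridian), $M$ consists of the points $\mathbf Z=t(s)\mathbf n+q(s)\mathbf e$, $s\in I$, $\mathbf n\in S^{2n-1}(1)\subset\mathbb C^n$. $M$ is of type I if $t(s)>0$, $t'(s)>0$ for $s\in I$; then $M$ is determined by $t=t(s)$, equivalently by $s=s(t)$. Kähler structure on $M$: $\bar g$ is the induced metric; $\bar\xi=\partial\mathbf Z/\partial s$; $\tilde{\bar\xi}=J_0\mathbf n$; $\bar\eta=\bar g(\bar\xi,\cdot)$, $\tilde{\bar\eta}=\bar g(\tilde{\bar\xi},\cdot)$; $D$ is the $\bar g$-orthogonal complement of $\mathrm{span}\{\bar\xi,\tilde{\bar\xi}\}$ in $TM$; $J|_D=J_0$,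 $J\bar\xi=\tilde{\bar\xi}$, $J\tilde{\bar\xi}=-\bar\xi$; $g=\bar g+(t'-1)(\bar\eta\otimes\bar\eta+\tilde{\bar\eta}\otimes\tilde{\bar\eta})$, which is a Kähler metric on $(M,J)$. A Kähler metric $g$ is Bochner-Kähler if its Bochner tensor vanishes: in local holomorphic coordinates, with curvature tensor $R$, Ricci tensor $\rho$ and scalar curvature $\tau$, where $R(X,Y)Z=\nabla_X\nabla_YZ-\nabla_Y\nabla_XZ-\nabla_{[X,Y]}Z$, $R(X,Y,Z,U)=g(R(X,Y)Z,U)$, $\rho(Y,Z)=\sum_iR(e_i,Y,Z,e_i)$, $\tau=\sum_i\rho(e_i,e_i)$, $$R_{\alpha\bar\beta\gamma\bar\delta}-\tfrac1{n+2}(g_{\alpha\bar\beta}\rho_{\gamma\bar\delta}+g_{\gamma\bar\beta}\rho_{\alpha\bar\delta}+g_{\gamma\bar\delta}\rho_{\alpha\bar\beta}+g_{\alpha\bar\delta}\rho_{\gamma\bar\beta})+\tfrac{\tau}{2(n+1)(n+2)}(g_{\alpha\bar\beta}g_{\gamma\bar\delta}+g_{\gamma\bar\beta}g_{\alpha\bar\delta})=0 .$$ *)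

theory Defs
  imports "HOL-Analysis.Analysis"
begin

section \<open>Smooth maps\<close>

primrec Ck_on :: "nat \<Rightarrow> 'a::euclidean_space set \<Rightarrow> ('a \<Rightarrow> 'b::real_normed_vector) \<Rightarrow> bool" where
  "Ck_on 0 U f \<longleftrightarrow> continuous_on U f"
| "Ck_on (Suc k) U f \<longleftrightarrow>
     (\<forall>x\<in>U. f differentiable (at x)) \<and> (\<forall>v. Ck_on k U (\<lambda>x. frechet_derivative f (at x) v))"

text \<open>Meant for open sets \<open>U\<close>.\<close>

definition smooth_on :: "'a::euclidean_space set \<Rightarrow> ('a \<Rightarrow> 'b::real_normed_vector) \<Rightarrow> bool" where
  "smooth_on U f \<longleftrightarrow> (\<forall>k. Ck_on k U f)"


section \<open>Riemannian and Kaehler geometry in a chart\<close>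

text \<open>
  A tensor field on an open subset of a Euclidean space \<open>'a\<close> assigns to each point a (multi)linear
  map on the tangent space \<open>'a\<close>; a vector field is a function \<open>'a \<Rightarrow> 'a\<close>. Every tangent vector
  extends to a constant (coordinate) vector field.
\<close>

type_synonym 'a metric_field = "'a \<Rightarrow> 'a \<Rightarrow> 'a \<Rightarrow> real"
type_synonym 'a endo_field = "'a \<Rightarrow> 'a \<Rightarrow> 'a"
type_synonym 'a vfield = "'a \<Rightarrow> 'a"

abbreviation Dir :: "('a::euclidean_space \<Rightarrow> 'b::real_normed_vector) \<Rightarrow> 'a \<Rightarrow> 'a \<Rightarrow> 'b" where
  "Dir f p v \<equiv> frechet_derivative f (at p) v"

definition lie_bracket :: "'a::euclidean_space vfield \<Rightarrow> 'a vfield \<Rightarrow> 'a vfield" where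
  "lie_bracket X Y p = Dir Y p (X p) - Dir X p (Y p)"

text \<open>The Levi-Civita connection: the Koszul formula on constant vector fields gives the
  Christoffel symbols, the correction to the flat derivative.\<close>

definition christoffel :: "'a::euclidean_space metric_field \<Rightarrow> 'a \<Rightarrow> 'a \<Rightarrow> 'a \<Rightarrow> 'a" where
  "christoffel g p x y = (THE w. \<forall>z. 2 * g p w z =
      Dir (\<lambda>a. g a y z) p x + Dir (\<lambda>a. g a x z) p y - Dir (\<lambda>a. g a x y) p z)"

definition nabla :: "'a::euclidean_space metric_field \<Rightarrow> 'a vfield \<Rightarrow> 'a vfield \<Rightarrow> 'a vfield" where
  "nabla g X Y p = Dir Y p (X p) + christoffel g p (X p) (Y p)"

definition curvature_op ::
    "'a::euclidean_space metric_field \<Rightarrow> 'a vfield \<Rightarrow> 'a vfield \<Rightarrow> 'a vfield \<Rightarrow> 'a vfield" where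
  "curvature_op g X Y Z p =
     nabla g X (nabla g Y Z) p - nabla g Y (nabla g X Z) p - nabla g (lie_bracket X Y) Z p"

definition Riem :: "'a::euclidean_space metric_field \<Rightarrow> 'a \<Rightarrow> 'a \<Rightarrow> 'a \<Rightarrow> 'a \<Rightarrow> 'a \<Rightarrow> real" where
  "Riem g p x y z u = g p (curvature_op g (\<lambda>_. x) (\<lambda>_. y) (\<lambda>_. z) p) u"

definition orthonormal_basis :: "'a::euclidean_space metric_field \<Rightarrow> 'a \<Rightarrow> 'a set \<Rightarrow> bool" where
  "orthonormal_basis g p B \<longleftrightarrow>
     finite B \<and> span B = UNIV \<and> (\<forall>a\<in>B. \<forall>b\<in>B. g p a b = (if a = b then 1 else 0))"

text \<open>The traces do not depend on the orthonormal basis.\<close>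

definition Ric :: "'a::euclidean_space metric_field \<Rightarrow> 'a \<Rightarrow> 'a \<Rightarrow> 'a \<Rightarrow> real" where
  "Ric g p y z = (\<Sum>e\<in>(SOME B. orthonormal_basis g p B). Riem g p e y z e)"

definition scal :: "'a::euclidean_space metric_field \<Rightarrow> 'a \<Rightarrow> real" where
  "scal g p = (\<Sum>e\<in>(SOME B. orthonormal_basis g p B). Ric g p e e)"

definition riemannian_on :: "'a::euclidean_space set \<Rightarrow> 'a metric_field \<Rightarrow> bool" where
  "riemannian_on U g \<longleftrightarrow>
     (\<forall>u v. smooth_on U (\<lambda>p. g p u v)) \<and>
     (\<forall>p\<in>U. bilinear (g p) \<and> (\<forall>u v. g p u v = g p v u) \<and> (\<forall>u. u \<noteq> 0 \<longrightarrow> g p u u > 0))"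

text \<open>Kaehler: \<open>J\<close> is an almost complex structure, \<open>g\<close> is Hermitian, and \<open>\<nabla>J = 0\<close> (which
  entails the integrability of \<open>J\<close>).\<close>

definition kahler_on :: "'a::euclidean_space set \<Rightarrow> 'a metric_field \<Rightarrow> 'a endo_field \<Rightarrow> bool" where
  "kahler_on U g J \<longleftrightarrow>
     open U \<and> riemannian_on U g \<and>
     (\<forall>u. smooth_on U (\<lambda>p. J p u)) \<and>
     (\<forall>p\<in>U. linear (J p) \<and> (\<forall>u. J p (J p u) = - u) \<and>
            (\<forall>u v. g p (J p u) (J p v) = g p u v) \<and>
            (\<forall>u v. nabla g (\<lambda>_. u) (\<lambda>q. J q v) p = J p (nabla g (\<lambda>_. u) (\<lambda>_. v) p)))"

text \<open>
  The complexified tangent space is \<open>'a \<times> 'a\<close>: the pair \<open>(x, y)\<close> stands for \<open>x + iy\<close>. Real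
  multilinear forms are extended to it complex multilinearly.
\<close>

definition cext :: "('a \<Rightarrow> complex) \<Rightarrow> 'a \<times> 'a \<Rightarrow> complex" where
  "cext f V = f (fst V) + \<i> * f (snd V)"

definition cext2 :: "('a \<Rightarrow> 'a \<Rightarrow> real) \<Rightarrow> 'a \<times> 'a \<Rightarrow> 'a \<times> 'a \<Rightarrow> complex" where
  "cext2 T V W = cext (\<lambda>v. cext (\<lambda>w. complex_of_real (T v w)) W) V"

definition cext4 :: "('a \<Rightarrow> 'a \<Rightarrow> 'a \<Rightarrow> 'a \<Rightarrow> real) \<Rightarrow>
    'a \<times> 'a \<Rightarrow> 'a \<times> 'a \<Rightarrow> 'a \<times> 'a \<Rightarrow> 'a \<times> 'a \<Rightarrow> complex" where
  "cext4 T V1 V2 V3 V4 =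
     cext (\<lambda>v1. cext (\<lambda>v2. cext (\<lambda>v3. cext (\<lambda>v4. complex_of_real (T v1 v2 v3 v4)) V4) V3) V2) V1"

definition conj_vec :: "'a::euclidean_space \<times> 'a \<Rightarrow> 'a \<times> 'a" where
  "conj_vec V = (fst V, - snd V)"

text \<open>Vectors of type (1,0): the \<open>i\<close>-eigenspace of the complexified \<open>J\<close>, that is, the complex
  span of the coordinate fields \<open>\<partial>/\<partial>z\<^sup>\<alpha>\<close> of any local holomorphic coordinates.\<close>

definition T10 :: "'a::euclidean_space endo_field \<Rightarrow> 'a \<Rightarrow> ('a \<times> 'a) set" where
  "T10 J p = {V. (J p (fst V), J p (snd V)) = (- snd V, fst V)}"

text \<open>For \<open>A = \<partial>/\<partial>z\<^sup>\<alpha>\<close>, \<open>B = \<partial>/\<partial>z\<^sup>\<beta>\<close>, \<open>C = \<partial>/\<partial>z\<^sup>\<gamma>\<close>, \<open>E = \<partial>/\<partial>z\<^sup>\<delta>\<close> the number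
  \<open>bochner g p A (conj_vec B) C (conj_vec E)\<close> is the component of the Bochner tensor with indices
  \<alpha>, \<beta> bar, \<gamma>, \<delta> bar; \<open>n\<close> is the complex dimension.\<close>

definition bochner :: "'a::euclidean_space metric_field \<Rightarrow> 'a \<Rightarrow>
    'a \<times> 'a \<Rightarrow> 'a \<times> 'a \<Rightarrow> 'a \<times> 'a \<Rightarrow> 'a \<times> 'a \<Rightarrow> complex" where
  "bochner g p A B C E =
    (let n = of_nat DIM('a) / 2 :: complex; G = cext2 (g p); \<rho> = cext2 (Ric g p);
         \<tau> = complex_of_real (scal g p)
     in cext4 (Riem g p) A B C E
        - 1 / (n + 2) * (G A B * \<rho> C E + G C B * \<rho> A E + G C E * \<rho> A B + G A E * \<rho> C B)
        + \<tau> / (2 * (n + 1) * (n + 2)) * (G A B * G C E + G C B * G A E))"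

definition bochner_kahler_on ::
    "'a::euclidean_space set \<Rightarrow> 'a metric_field \<Rightarrow> 'a endo_field \<Rightarrow> bool" where
  "bochner_kahler_on U g J \<longleftrightarrow>
     kahler_on U g J \<and>
     (\<forall>p\<in>U. \<forall>A\<in>T10 J p. \<forall>B\<in>T10 J p. \<forall>C\<in>T10 J p. \<forall>E\<in>T10 J p.
        bochner g p A (conj_vec B) C (conj_vec E) = 0)"


section \<open>Rotational hypersurfaces of type I\<close>

text \<open>The ambient space is \<open>complex ^ 'n \<times> real\<close> with its Euclidean product metric, and the
  unit vector spanning the real axis is \<open>(0, 1)\<close>.\<close>

type_synonym 'n ambient = "(complex ^ 'n) \<times> real"

definition J0 :: "complex ^ 'n \<Rightarrow> complex ^ 'n" where
  "J0 v = \<i> *s v"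

definition type_I_meridian :: "real set \<Rightarrow> (real \<Rightarrow> real) \<Rightarrow> (real \<Rightarrow> real) \<Rightarrow> bool" where
  "type_I_meridian I t q \<longleftrightarrow>
     open I \<and> is_interval I \<and> smooth_on I t \<and> smooth_on I q \<and>
     (\<forall>s\<in>I. (deriv t s)\<^sup>2 + (deriv q s)\<^sup>2 = 1 \<and> t s > 0 \<and> deriv t s > 0)"

definition rot_point ::
    "(real \<Rightarrow> real) \<Rightarrow> (real \<Rightarrow> real) \<Rightarrow> real \<Rightarrow> complex ^ 'n::finite \<Rightarrow> 'n ambient" where
  "rot_point t q s n = (t s *\<^sub>R n, q s)"

definition rot_hypersurface ::
    "real set \<Rightarrow> (real \<Rightarrow> real) \<Rightarrow> (real \<Rightarrow> real) \<Rightarrow> ('n::finite) ambient set" where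
  "rot_hypersurface I t q = {rot_point t q s n | s n. s \<in> I \<and> n \<in> sphere 0 1}"

text \<open>The inverse function \<open>s(t)\<close>, and the parameters \<open>s\<close>, \<open>n\<close> of a point of the hypersurface.\<close>

definition s_of :: "real set \<Rightarrow> (real \<Rightarrow> real) \<Rightarrow> real \<Rightarrow> real" where
  "s_of I t = the_inv_into I t"

definition s_at :: "real set \<Rightarrow> (real \<Rightarrow> real) \<Rightarrow> ('n::finite) ambient \<Rightarrow> real" where
  "s_at I t P = s_of I t (norm (fst P))"

definition n_at :: "('n::finite) ambient \<Rightarrow> complex ^ 'n" where
  "n_at P = sgn (fst P)"

text \<open>
  The tensors below are given on the whole ambient space at a point \<open>P\<close> of the hypersurface;
  only their values on tangent vectors of the hypersurface matter. There the induced metric is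
  the ambient inner product.
\<close>

definition xi ::
    "real set \<Rightarrow> (real \<Rightarrow> real) \<Rightarrow> (real \<Rightarrow> real) \<Rightarrow> ('n::finite) ambient \<Rightarrow> 'n ambient" where
  "xi I t q P = vector_derivative (\<lambda>s. rot_point t q s (n_at P)) (at (s_at I t P))"

definition xi_tilde :: "('n::finite) ambient \<Rightarrow> 'n ambient" where
  "xi_tilde P = (J0 (n_at P), 0)"

definition eta ::
    "real set \<Rightarrow> (real \<Rightarrow> real) \<Rightarrow> (real \<Rightarrow> real) \<Rightarrow> ('n::finite) ambient \<Rightarrow> 'n ambient \<Rightarrow> real" where
  "eta I t q P X = xi I t q P \<bullet> X"

definition eta_tilde :: "('n::finite) ambient \<Rightarrow> 'n ambient \<Rightarrow> real" where
  "eta_tilde P X = xi_tilde P \<bullet> X"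

definition g_M :: "real set \<Rightarrow> (real \<Rightarrow> real) \<Rightarrow> (real \<Rightarrow> real) \<Rightarrow> ('n::finite) ambient metric_field" where
  "g_M I t q P X Y =
     X \<bullet> Y + (deriv t (s_at I t P) - 1) *
               (eta I t q P X * eta I t q P Y + eta_tilde P X * eta_tilde P Y)"

text \<open>The component in \<open>D\<close> of a tangent vector; \<open>xi\<close> and \<open>xi_tilde\<close> are orthonormal for the
  induced metric. The vectors of \<open>D\<close> have no component along the real axis.\<close>

definition D_part ::
    "real set \<Rightarrow> (real \<Rightarrow> real) \<Rightarrow> (real \<Rightarrow> real) \<Rightarrow> ('n::finite) ambient \<Rightarrow> 'n ambient \<Rightarrow> 'n ambient" where
  "D_part I t q P X = X - eta I t q P X *\<^sub>R xi I t q P - eta_tilde P X *\<^sub>R xi_tilde P"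

definition J_M :: "real set \<Rightarrow> (real \<Rightarrow> real) \<Rightarrow> (real \<Rightarrow> real) \<Rightarrow> ('n::finite) ambient endo_field" where
  "J_M I t q P X =
     eta I t q P X *\<^sub>R xi_tilde P - eta_tilde P X *\<^sub>R xi I t q P
     + (J0 (fst (D_part I t q P X)), 0)"

text \<open>
  For type I the projection \<open>fst\<close> restricts to a diffeomorphism of the hypersurface onto the open
  set \<open>chart_dom\<close>, with inverse \<open>graph_map\<close>: a global chart. The structure is expressed in it;
  the differential of the chart is again \<open>fst\<close>.
\<close>

definition chart_dom ::
    "real set \<Rightarrow> (real \<Rightarrow> real) \<Rightarrow> (real \<Rightarrow> real) \<Rightarrow> (complex ^ 'n::finite) set" where
  "chart_dom I t q = fst ` rot_hypersurface I t q"

definition graph_map ::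
    "real set \<Rightarrow> (real \<Rightarrow> real) \<Rightarrow> (real \<Rightarrow> real) \<Rightarrow> complex ^ 'n::finite \<Rightarrow> 'n ambient" where
  "graph_map I t q x = (x, q (s_of I t (norm x)))"

definition g_chart ::
    "real set \<Rightarrow> (real \<Rightarrow> real) \<Rightarrow> (real \<Rightarrow> real) \<Rightarrow> (complex ^ 'n::finite) metric_field" where
  "g_chart I t q x u v =
     g_M I t q (graph_map I t q x) (Dir (graph_map I t q) x u) (Dir (graph_map I t q) x v)"

definition J_chart ::
    "real set \<Rightarrow> (real \<Rightarrow> real) \<Rightarrow> (real \<Rightarrow> real) \<Rightarrow> (complex ^ 'n::finite) endo_field" where
  "J_chart I t q x u = fst (J_M I t q (graph_map I t q x) (Dir (graph_map I t q) x u))"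

end

theory Submission
  imports Defs
begin

text \<open>
  In the chart, with \<open>\<rho> = \<bar>x\<bar>\<^sup>2\<close> and \<open>B(\<rho>) = (t' - 1) / \<rho>\<close>, \<open>g\<close> and \<open>J\<close> depend on the single
  function \<open>B\<close>. The Christoffel symbols and the curvature can then be computed in closed form:
  with \<open>\<omega> = g(J\<cdot>, \<cdot>)\<close>, \<open>\<theta>\<close> equal to \<open>\<rho>\<close> times the restriction of \<open>g\<close> to the complex line of
  \<open>\<xi>\<close>, and \<open>\<nu> = \<theta>(J\<cdot>, \<cdot>)\<close>, one finds
  \<open>R = -B R\<^sub>0(g, g) - B' (R\<^sub>0(g, \<theta>) + R\<^sub>0(\<theta>, g)) + 2 B'' \<nu> \<otimes> \<nu>\<close>, where \<open>R\<^sub>0(g, g)\<close> is the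
  curvature tensor of constant holomorphic curvature \<open>4\<close>. The first two terms do not contribute to
  the Bochner tensor, while the last one does as soon as some direction is transversal to the
  complex line, so \<open>g\<close> is Bochner-Kaehler iff \<open>B'' = 0\<close>, that is
  \<open>t' = 1 + \<rho> B(\<rho>) = 1 + c\<^sub>2 t\<^sup>2 + c\<^sub>1 t\<^sup>4\<close>.
\<close>

section \<open>Smooth maps\<close>

text \<open>Differentiability at a point is local. The equality of derivatives holds even where
  neither function is differentiable, because \<open>frechet_derivative\<close> then chooses by the
  same predicate on both sides.\<close>

lemma frechet_derivative_cong_open:
  assumes "open U" "x \<in> U" "\<And>y. y \<in> U \<Longrightarrow> f y = g y"
  shows "frechet_derivative f (at x) = frechet_derivative g (at x)"
    and "f differentiable (at x) \<Longrightarrow> g differentiable (at x)"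
proof -
  have iff: "(f has_derivative D) (at x) \<longleftrightarrow> (g has_derivative D) (at x)" for D
    using has_derivative_transform_within_open[OF _ assms(1,2), of f D UNIV g]
      has_derivative_transform_within_open[OF _ assms(1,2), of g D UNIV f] assms(3) by auto
  show "frechet_derivative f (at x) = frechet_derivative g (at x)"
    by (simp add: frechet_derivative_def iff)
  show "f differentiable (at x) \<Longrightarrow> g differentiable (at x)"
    by (simp add: differentiable_def iff)
qed

lemma Ck_on_cong:
  assumes "open U" "\<And>x. x \<in> U \<Longrightarrow> f x = g x" "Ck_on k U f"
  shows "Ck_on k U g"
  using assms(2,3)
proof (induction k arbitrary: f g)
  case 0
  then show ?case by (simp cong: continuous_on_cong)
next
  case (Suc k)
  have "Ck_on k U (\<lambda>x. frechet_derivative g (at x) v)" for v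
    by (rule Suc.IH[of "\<lambda>x. frechet_derivative f (at x) v"])
      (use Suc.prems frechet_derivative_cong_open(1)[OF assms(1), of _ f g] in auto)
  moreover have "g differentiable (at x)" if "x \<in> U" for x
    using Suc.prems that frechet_derivative_cong_open(2)[OF assms(1) that, of f g] by simp
  ultimately show ?case by simp
qed

lemma Ck_on_SucD: "Ck_on (Suc k) U f \<Longrightarrow> Ck_on k U f"
proof (induction k arbitrary: f)
  case 0
  then show ?case
    by (auto intro!: continuous_at_imp_continuous_on differentiable_imp_continuous_within)
qed simp

text \<open>Lets the derivative be supplied in any closed form valid on \<open>U\<close>, so that
  inductions on \<open>k\<close> can work with the usual differentiation rules.\<close>

lemma Ck_on_SucI:
  assumes "open U" "\<And>x. x \<in> U \<Longrightarrow> (f has_derivative D x) (at x)" "\<And>v. Ck_on k U (\<lambda>x. D x v)"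
  shows "Ck_on (Suc k) U f"
proof -
  have "Ck_on k U (\<lambda>x. frechet_derivative f (at x) v)" for v
    by (rule Ck_on_cong[OF assms(1) _ assms(3)]) (simp add: frechet_derivative_at[OF assms(2), symmetric])
  then show ?thesis
    using assms(2) by (auto simp: differentiable_def)
qed

lemma Ck_on_Suc_has_derivative:
  "Ck_on (Suc k) U f \<Longrightarrow> x \<in> U \<Longrightarrow> (f has_derivative frechet_derivative f (at x)) (at x)"
  by (simp add: frechet_derivative_works[symmetric])

lemma Ck_on_const: "open U \<Longrightarrow> Ck_on k U (\<lambda>_. c)"
  by (induction k arbitrary: c) auto

lemma Ck_on_bounded_linear:
  assumes "open U" "bounded_linear f"
  shows "Ck_on k U f"
proof (cases k)
  case 0
  then show ?thesis using assms by (simp add: linear_continuous_on)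
next
  case (Suc m)
  show ?thesis
    unfolding Suc
    by (rule Ck_on_SucI[OF assms(1) bounded_linear_imp_has_derivative[OF assms(2)]])
      (rule Ck_on_const[OF assms(1)])
qed

lemma Ck_on_add:
  assumes "open U" "Ck_on k U f" "Ck_on k U g"
  shows "Ck_on k U (\<lambda>x. f x + g x)"
  using assms(2,3)
proof (induction k arbitrary: f g)
  case (Suc k)
  show ?case
    by (rule Ck_on_SucI[OF assms(1) has_derivative_add[OF Ck_on_Suc_has_derivative[OF Suc.prems(1)]
          Ck_on_Suc_has_derivative[OF Suc.prems(2)]]]) (use Suc in auto)
qed (auto intro: continuous_intros)

text \<open>Leibniz rule: the derivative is a sum of two products of the same kind, each with one
  factor differentiated, so both fall under the induction hypothesis.\<close>

lemma (in bounded_bilinear) Ck_on: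
  assumes "open U" "Ck_on k U f" "Ck_on k U g"
  shows "Ck_on k U (\<lambda>x. prod (f x) (g x))"
  using assms(2,3)
proof (induction k arbitrary: f g)
  case (Suc k)
  note D = FDERIV[OF Ck_on_Suc_has_derivative[OF Suc.prems(1)] Ck_on_Suc_has_derivative[OF Suc.prems(2)]]
  show ?case
    by (rule Ck_on_SucI[OF assms(1) D]; (assumption)?)
      (use Suc.prems Suc.prems[THEN Ck_on_SucD] in \<open>auto intro!: Ck_on_add[OF assms(1)] Suc.IH\<close>)
qed (auto intro: continuous_on)

lemmas Ck_on_mult = bounded_bilinear.Ck_on[OF bounded_bilinear_mult]

text \<open>The derivative \<open>- f' / f^2\<close> contains only \<open>f'\<close> and
  \<open>1 / f\<close> again; the induction hypothesis gives order \<open>k\<close> for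
  \<open>1 / f\<close> and hence for the derivative.\<close>

lemma Ck_on_inverse:
  fixes f :: "'a::euclidean_space \<Rightarrow> real"
  assumes "open U" "\<And>x. x \<in> U \<Longrightarrow> f x \<noteq> 0" "Ck_on k U f"
  shows "Ck_on k U (\<lambda>x. inverse (f x))"
  using assms(3)
proof (induction k)
  case 0
  then show ?case using assms(2) by (auto intro: continuous_intros)
next
  case (Suc k)
  then have inv: "Ck_on k U (\<lambda>x. inverse (f x))" by (blast dest: Ck_on_SucD)
  have "Ck_on k U (\<lambda>x. (-1) * (inverse (f x) * frechet_derivative f (at x) v * inverse (f x)))" for v
    using Suc.prems by (intro Ck_on_mult Ck_on_const inv assms(1)) auto
  then show ?case
    by (intro Ck_on_SucI[OF assms(1) Deriv.has_derivative_inverse[OF assms(2) Ck_on_Suc_has_derivative[OF Suc.prems]]])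
      auto
qed

lemma smooth_on_cong:
  "open U \<Longrightarrow> (\<And>x. x \<in> U \<Longrightarrow> f x = g x) \<Longrightarrow> smooth_on U f \<Longrightarrow> smooth_on U g"
  unfolding smooth_on_def using Ck_on_cong by blast

lemma smooth_on_const: "open U \<Longrightarrow> smooth_on U (\<lambda>_. c)"
  by (simp add: smooth_on_def Ck_on_const)

lemma smooth_on_bounded_linear: "open U \<Longrightarrow> bounded_linear f \<Longrightarrow> smooth_on U f"
  by (simp add: smooth_on_def Ck_on_bounded_linear)

lemma smooth_on_add: "open U \<Longrightarrow> smooth_on U f \<Longrightarrow> smooth_on U g \<Longrightarrow> smooth_on U (\<lambda>x. f x + g x)"
  by (simp add: smooth_on_def Ck_on_add)

lemma smooth_on_mult:
  fixes f g :: "'a::euclidean_space \<Rightarrow> real"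
  shows "open U \<Longrightarrow> smooth_on U f \<Longrightarrow> smooth_on U g \<Longrightarrow> smooth_on U (\<lambda>x. f x * g x)"
  by (simp add: smooth_on_def Ck_on_mult)

lemma smooth_on_scaleR:
  "open U \<Longrightarrow> smooth_on U f \<Longrightarrow> smooth_on U g \<Longrightarrow> smooth_on U (\<lambda>x. f x *\<^sub>R g x)"
  by (simp add: smooth_on_def bounded_bilinear.Ck_on[OF bounded_bilinear_scaleR])

lemma smooth_on_inner:
  fixes f g :: "'a::euclidean_space \<Rightarrow> 'b::real_inner"
  shows "open U \<Longrightarrow> smooth_on U f \<Longrightarrow> smooth_on U g \<Longrightarrow> smooth_on U (\<lambda>x. f x \<bullet> g x)"
  by (simp add: smooth_on_def bounded_bilinear.Ck_on[OF bounded_bilinear_inner])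

lemma smooth_on_diff:
  "open U \<Longrightarrow> smooth_on U f \<Longrightarrow> smooth_on U g \<Longrightarrow> smooth_on U (\<lambda>x. f x - g x)"
  using smooth_on_add[of U f "\<lambda>x. (-1) *\<^sub>R g x"] smooth_on_scaleR[of U "\<lambda>_. -1" g]
  by (simp add: smooth_on_const)

lemma smooth_on_divide:
  fixes f g :: "'a::euclidean_space \<Rightarrow> real"
  shows "open U \<Longrightarrow> smooth_on U f \<Longrightarrow> smooth_on U g \<Longrightarrow> (\<And>x. x \<in> U \<Longrightarrow> g x \<noteq> 0) \<Longrightarrow>
    smooth_on U (\<lambda>x. f x / g x)"
  unfolding divide_inverse by (intro smooth_on_mult) (simp_all add: smooth_on_def Ck_on_inverse)

lemmas smooth_intros = smooth_on_const smooth_on_bounded_linear[OF _ bounded_linear_ident]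
  smooth_on_add smooth_on_diff smooth_on_mult smooth_on_scaleR smooth_on_inner smooth_on_divide

lemma smooth_on_real:
  fixes f :: "real \<Rightarrow> real"
  assumes "open I" "smooth_on I f"
  shows "x \<in> I \<Longrightarrow> (f has_real_derivative deriv f x) (at x)" and "smooth_on I (deriv f)"
proof -
  have D: "(f has_real_derivative deriv f x) (at x)" if "x \<in> I" for x
  proof -
    have "f differentiable (at x)"
      using assms(2)[unfolded smooth_on_def, THEN spec, of "Suc 0"] that by simp
    then show ?thesis
      by (simp add: DERIV_deriv_iff_real_differentiable)
  qed
  show "x \<in> I \<Longrightarrow> (f has_real_derivative deriv f x) (at x)" by (rule D)
  have "Ck_on k I (deriv f)" for k
  proof (rule Ck_on_cong[OF assms(1)])
    show "Ck_on k I (\<lambda>x. frechet_derivative f (at x) 1)"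
      using assms(2)[unfolded smooth_on_def, THEN spec, of "Suc k"] by simp
    show "frechet_derivative f (at x) 1 = deriv f x" if "x \<in> I" for x
      using fun_cong[OF frechet_derivative_at[OF D[OF that, unfolded has_field_derivative_def]], of 1]
      by simp
  qed
  then show "smooth_on I (deriv f)" by (simp add: smooth_on_def)
qed

lemma has_derivative_radial:
  fixes x :: "'a::real_inner"
  assumes "(f has_real_derivative d) (at (x \<bullet> x))"
  shows "((\<lambda>a. f (a \<bullet> a)) has_derivative (\<lambda>w. d * (2 * (x \<bullet> w)))) (at x)"
proof -
  have "((\<lambda>a. a \<bullet> a) has_derivative (\<lambda>w. 2 * (x \<bullet> w))) (at x)"
    by (auto intro!: derivative_eq_intros simp: inner_commute)
  from has_derivative_compose[OF this] assms show ?thesis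
    by (simp add: has_field_derivative_def)
qed

section \<open>Curvature-like tensors and their complexification\<close>

text \<open>The product \<open>R_0(h, h')\<close> of the overview, with the skew forms belonging to
  \<open>h\<close> and \<open>h'\<close> passed as separate arguments.\<close>

definition kulkarni :: "('a \<Rightarrow> 'a \<Rightarrow> real) \<Rightarrow> ('a \<Rightarrow> 'a \<Rightarrow> real) \<Rightarrow> ('a \<Rightarrow> 'a \<Rightarrow> real) \<Rightarrow> ('a \<Rightarrow> 'a \<Rightarrow> real) \<Rightarrow>
    'a \<Rightarrow> 'a \<Rightarrow> 'a \<Rightarrow> 'a \<Rightarrow> real" where
  "kulkarni h \<omega> h' \<omega>' x y z u =
     h y z * h' x u - h x z * h' y u + \<omega> y z * \<omega>' x u - \<omega> x z * \<omega>' y u - 2 * \<omega> x y * \<omega>' z u"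

lemma cext4_kulkarni: "cext4 (kulkarni h \<omega> h' \<omega>') A B C E =
    cext2 h B C * cext2 h' A E - cext2 h A C * cext2 h' B E
    + cext2 \<omega> B C * cext2 \<omega>' A E - cext2 \<omega> A C * cext2 \<omega>' B E - 2 * cext2 \<omega> A B * cext2 \<omega>' C E"
  unfolding cext4_def cext2_def cext_def kulkarni_def by (simp add: algebra_simps)

lemma cext4_prod: "cext4 (\<lambda>x y z u. h x y * h' z u) A B C E = cext2 h A B * cext2 h' C E"
  unfolding cext4_def cext2_def cext_def by (simp add: algebra_simps)

lemma cext4_linear:
  "cext4 (\<lambda>x y z u. a * R x y z u - b * (R' x y z u + R'' x y z u) + c * h x y * h' z u) A B C E =
     of_real a * cext4 R A B C E - of_real b * (cext4 R' A B C E + cext4 R'' A B C E)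
     + of_real c * cext4 (\<lambda>x y z u. h x y * h' z u) A B C E"
  unfolding cext4_def cext_def by (simp add: algebra_simps)

text \<open>A \<open>J\<close>-invariant symmetric form with its associated skew form. Linearity is
  recorded as a sign rule, which is the form in which conjugation and the eigenvalue relation of
  (1,0) vectors use it.\<close>

definition hermitian_pair ::
    "'a::euclidean_space endo_field \<Rightarrow> 'a \<Rightarrow> ('a \<Rightarrow> 'a \<Rightarrow> real) \<Rightarrow> ('a \<Rightarrow> 'a \<Rightarrow> real) \<Rightarrow> bool" where
  "hermitian_pair J p h \<omega> \<longleftrightarrow> (\<forall>u v. h v u = h u v \<and> h (- u) v = - h u v \<and> h (J p u) (J p v) = h u v \<and>
     \<omega> u v = h (J p u) v \<and> \<omega> (- u) v = - \<omega> u v)"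

text \<open>A (1,0) vector is an eigenvector of \<open>J\<close> for i and its conjugate is one for
  -i, so \<open>h (J A) W\<close> is a multiple of \<open>h A W\<close>.\<close>

lemma hermitian_pair_om:
  assumes "hermitian_pair J p h \<omega>" "A \<in> T10 J p"
  shows "cext2 \<omega> A W = \<i> * cext2 h A W" "cext2 \<omega> (conj_vec A) W = - \<i> * cext2 h (conj_vec A) W"
proof -
  have J: "J p (fst A) = - snd A" "J p (snd A) = fst A" using assms(2) by (auto simp: T10_def)
  have h: "\<omega> u v = h (J p u) v" "h (- u) v = - h u v" "\<omega> (- u) v = - \<omega> u v" for u v
    using assms(1) unfolding hermitian_pair_def by blast+
  have "\<omega> (fst A) v = - h (snd A) v" "\<omega> (snd A) v = h (fst A) v" for v
    by (simp_all add: h(1) J h(2))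
  then show "cext2 \<omega> A W = \<i> * cext2 h A W" "cext2 \<omega> (conj_vec A) W = - \<i> * cext2 h (conj_vec A) W"
    by (simp_all add: cext2_def cext_def conj_vec_def h(2,3) algebra_simps)
qed

text \<open>Invariance gives h(A, C) = h(JA, JC) = i^2 h(A, C) = - h(A, C).\<close>

lemma hermitian_pair_zero:
  assumes "hermitian_pair J p h \<omega>" "A \<in> T10 J p" "C \<in> T10 J p"
  shows "cext2 h A C = 0"
proof -
  have J: "J p (fst A) = - snd A" "J p (snd A) = fst A" "J p (fst C) = - snd C" "J p (snd C) = fst C"
    using assms(2,3) by (auto simp: T10_def)
  have h: "h (J p u) (J p v) = h u v" "h (- u) v = - h u v" "h u (- v) = - h u v" for u v
    using assms(1) unfolding hermitian_pair_def by metis+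
  have "h (snd A) (snd C) = h (fst A) (fst C)" "h (fst A) (snd C) = - h (snd A) (fst C)"
    using h(1)[of "fst A" "fst C"] h(1)[of "fst A" "snd C"] by (simp_all add: h J)
  then show ?thesis
    by (simp add: cext2_def cext_def algebra_simps)
qed

text \<open>Terms pairing two (1,0) vectors or two (0,1) vectors vanish. In the others the
  eigenvalues of \<open>J\<close> turn skew forms into symmetric ones, with factors (-i) i = 1 and
  -2 i i = 2.\<close>

lemma cext4_kulkarni_T10:
  assumes h: "hermitian_pair J p h \<omega>" and h': "hermitian_pair J p h' \<omega>'"
    and T: "A \<in> T10 J p" "B \<in> T10 J p" "C \<in> T10 J p" "E \<in> T10 J p"
  shows "cext4 (kulkarni h \<omega> h' \<omega>') A (conj_vec B) C (conj_vec E) =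
    2 * (cext2 h C (conj_vec B) * cext2 h' A (conj_vec E) + cext2 h A (conj_vec B) * cext2 h' C (conj_vec E))"
proof -
  have "h u v = h v u" for u v using h unfolding hermitian_pair_def by blast
  then have "cext2 h (conj_vec B) C = cext2 h C (conj_vec B)"
    by (simp add: cext2_def cext_def algebra_simps)
  then show ?thesis
    by (simp add: cext4_kulkarni hermitian_pair_om[OF h] hermitian_pair_om[OF h'] hermitian_pair_zero[OF h] T algebra_simps)
qed

text \<open>The Bochner combination for a curvature tensor of the form in \<open>Riem_eq\<close>.
  The \<open>g\<close> and \<open>t\<close> variables are values of the metric and of
  \<open>theta\<close> on a (1,0) and a (0,1) vector; after the curvature come the Ricci and scalar
  corrections. All terms in \<open>b\<close> and \<open>b1\<close> cancel.\<close>

lemma bochner_alg: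
  fixes n :: complex
  assumes n: "n + 1 \<noteq> 0" "n + 2 \<noteq> 0"
  shows "- 2 * b * (gCB * gAE + gAB * gCE) - 2 * b1 * (gCB * tAE + gAB * tCE + tCB * gAE + tAB * gCE)
      - 2 * b2 * (tAB * tCE)
    - 1 / (n + 2) *
      (gAB * (- (b * (2 * n + 2) + 2 * b1 * r) * gCE - (b1 * (2 * n + 4) + 2 * b2 * r) * tCE)
     + gCB * (- (b * (2 * n + 2) + 2 * b1 * r) * gAE - (b1 * (2 * n + 4) + 2 * b2 * r) * tAE)
     + gCE * (- (b * (2 * n + 2) + 2 * b1 * r) * gAB - (b1 * (2 * n + 4) + 2 * b2 * r) * tAB)
     + gAE * (- (b * (2 * n + 2) + 2 * b1 * r) * gCB - (b1 * (2 * n + 4) + 2 * b2 * r) * tCB))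
    + (- ((b * (2 * n + 2) + 2 * b1 * r) * (2 * n)) - (b1 * (2 * n + 4) + 2 * b2 * r) * (2 * r))
      / (2 * (n + 1) * (n + 2)) * (gAB * gCE + gCB * gAE)
   = - 2 * b2 * (tAB * tCE - r / (n + 2) * (gAB * tCE + gCB * tAE + gCE * tAB + gAE * tCB)
      + r\<^sup>2 / ((n + 1) * (n + 2)) * (gAB * gCE + gCB * gAE))"
proof -
  \<comment> \<open>The reciprocals become variables with polynomial relations, so that only a
    polynomial identity is left.\<close>
  define d e where "d = 1 / (n + 2)" "e = 1 / (n + 1)"
  have d: "d * (n + 2) = 1" and e: "e * (n + 1) = 1" using n by (simp_all add: d_e_def)
  have 1: "y / (n + 2) = y * d" "y / (2 * (n + 1) * (n + 2)) = y * d * e / 2" "y / ((n + 1) * (n + 2)) = y * d * e" for y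
    by (simp_all add: d_e_def)
  show ?thesis unfolding 1 using d e by algebra
qed

text \<open>
  The coefficient identity behind the curvature formula. For vectors \<open>u\<close>, \<open>v\<close>, \<open>w\<close>, \<open>z\<close> at the
  point \<open>x\<close> the letters stand for \<open>a = x \<bullet> _\<close>, \<open>b = j x \<bullet> _\<close>, \<open>c = a / p\<close>, \<open>n\<close> for the Euclidean
  inner product, \<open>g\<close> for the metric and \<open>o\<close> for the Kaehler form; \<open>S\<close> is
  \<open>g(\<partial>\<^sub>u \<Gamma>(v, w) + \<Gamma>(u, \<Gamma>(v, w)), z)\<close>. Expressing \<open>a\<close> through \<open>c\<close> and \<open>B'\<close> through \<open>k\<close>
  clears all denominators and leaves a polynomial identity.
\<close>

lemma riem_alg:
  fixes \<rho> B k k' :: real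
  assumes p: "p = 1 + \<rho> * B" and B1: "B' = p * k + B\<^sup>2" and m: "m = p * B' + 2 * B\<^sup>2"
    and p1: "p' = B + \<rho> * B'" and B2: "B'' = p' * k + p * k' + 2 * B * B'"
    and m1: "m' = p' * B' + p * B'' + 4 * B * B'"
    and a: "au = p * cu" "av = p * cv" "aw = p * cw" "az = p * cz"
    and n: "nuv = guv + B * p * cu * cv - B * bu * bv" "nuw = guw + B * p * cu * cw - B * bu * bw"
           "nvw = gvw + B * p * cv * cw - B * bv * bw"
    and gi: "giuz = ouz + B * bu * cz + B * p * cu * bz" "givz = ovz + B * bv * cz + B * p * cv * bz"
       "giwz = owz + B * bw * cz + B * p * cw * bz"
    and P: "P = - (k * av * aw + B * nvw + m * bv * bw)" "Q = k * (av * bw + aw * bv)"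
    and P': "P' = - (k * au * aw + B * nuw + m * bu * bw)" "Q' = k * (au * bw + aw * bu)"
    and S: "S = - (2 * k' * au * av * aw + k * (nuv * aw + av * nuw) + 2 * B' * au * nvw
              + 2 * m' * au * bv * bw + m * (ouv * bw + bv * ouw)) * cz
           + P * guz + (2 * k' * au * (av * bw + aw * bv) + k * (nuv * bw + av * ouw + nuw * bv + aw * ouv)) * (p * bz)
           + k * (av * bw + aw * bv) * giuz
           + 2 * B' * au * (bw * givz + bv * giwz) + B * (ouw * givz + ouv * giwz)
           + (- (k * au * aG + B * nuG + m * bu * bG)) * cz + k * (au * bG + aG * bu) * (p * bz)
           + B * (bG * giuz + bu * giGz)"
    and ovu: "ovu = - ouv"
    and S': "S' = - (2 * k' * av * au * aw + k * (nuv * aw + au * nvw) + 2 * B' * av * nuw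
              + 2 * m' * av * bu * bw + m * (ovu * bw + bu * ovw)) * cz
           + P' * gvz + (2 * k' * av * (au * bw + aw * bu) + k * (nuv * bw + au * ovw + nvw * bu + aw * ovu)) * (p * bz)
           + k * (au * bw + aw * bu) * givz
           + 2 * B' * av * (bw * giuz + bu * giwz) + B * (ovw * giuz + ovu * giwz)
           + (- (k * av * aG' + B * nvG' + m * bv * bG')) * cz + k * (av * bG' + aG' * bv) * (p * bz)
           + B * (bG' * givz + bv * giGz')"
    and G: "aG = \<rho> * P - 2 * B * bv * bw" "bG = \<rho> * Q + B * (bw * av + bv * aw)"
       "nuG = P * au + Q * bu - B * (bw * ouv + bv * ouw)"
       "giGz = P * (p * bz) - Q * cz - B * (bw * gvz + bv * gwz)"
    and G': "aG' = \<rho> * P' - 2 * B * bu * bw" "bG' = \<rho> * Q' + B * (bw * au + bu * aw)"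
       "nvG' = P' * av + Q' * bv - B * (bw * ovu + bu * ovw)"
       "giGz' = P' * (p * bz) - Q' * cz - B * (bw * guz + bu * gwz)"
  shows "S - S' = - B * (gvw * guz - guw * gvz + ovw * ouz - ouw * ovz - 2 * ouv * owz)
     - B' * (gvw * (p*(cu*cz+bu*bz)) + (p*(cv*cw+bv*bw)) * guz
          - guw * (p*(cv*cz+bv*bz)) - (p*(cu*cw+bu*bw)) * gvz
          + ovw * (au * bz - bu * az) + (av * bw - bv * aw) * ouz
          - ouw * (av * bz - bv * az) - (au * bw - bu * aw) * ovz
          - 2 * ouv * (aw * bz - bw * az) - 2 * (au * bv - bu * av) * owz)
     + 2 * B'' * (au * bv - bu * av) * (aw * bz - bw * az)"
  unfolding S S' G G' ovu P P' n gi a m m1 B2 p1 B1 p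
  by algebra

section \<open>Rotational metrics on a Euclidean space\<close>

text \<open>\<open>B1\<close> and \<open>B2\<close> are the first two derivatives of \<open>B\<close>, all three as functions of \<open>x \<bullet> x\<close>; the
  complex structure \<open>j\<close> is the standard one, whereas \<open>J\<close> is the one of the Kaehler structure.\<close>

locale rotational_metric =
  fixes j :: "'a::euclidean_space \<Rightarrow> 'a" and T :: "real set" and B B1 B2 :: "real \<Rightarrow> real"
    and g :: "'a metric_field" and J :: "'a endo_field"
  assumes j_linear: "linear j" and j_j: "\<And>u. j (j u) = - u"
    and j_isometry: "\<And>u v. j u \<bullet> j v = u \<bullet> v"
    and open_T: "open T" and T_pos: "\<And>r. r \<in> T \<Longrightarrow> 0 < r"
    and P_pos': "\<And>r. r \<in> T \<Longrightarrow> 0 < 1 + r * B r"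
    and DB: "\<And>r. r \<in> T \<Longrightarrow> (B has_real_derivative B1 r) (at r)"
    and DB1: "\<And>r. r \<in> T \<Longrightarrow> (B1 has_real_derivative B2 r) (at r)"
    and g_eq: "\<And>x u v. x \<bullet> x \<in> T \<Longrightarrow> g x u v =
        u \<bullet> v - B (x \<bullet> x) / (1 + x \<bullet> x * B (x \<bullet> x)) * (x \<bullet> u) * (x \<bullet> v)
        + B (x \<bullet> x) * (j x \<bullet> u) * (j x \<bullet> v)"
    and J_eq: "\<And>x u. x \<bullet> x \<in> T \<Longrightarrow> J x u =
        j u - (B (x \<bullet> x) / (1 + x \<bullet> x * B (x \<bullet> x)) * (x \<bullet> u)) *\<^sub>R j x
        - (B (x \<bullet> x) * (j x \<bullet> u)) *\<^sub>R x"
begin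

definition U :: "'a set" where "U = {x. x \<bullet> x \<in> T}"
definition P :: "real \<Rightarrow> real" where "P r = 1 + r * B r"
text \<open>\<open>K\<close> is determined by \<open>(B / P)' = K / P\<close> and absorbs
  denominators of the connection. \<open>M\<close> is the factor of
  \<open>(j x \<bullet> u) * (j x \<bullet> v)\<close> in the radial part of the Christoffel
  symbols; \<open>K1\<close> and \<open>M1\<close> are the derivatives of \<open>K\<close> and
  \<open>M\<close>.\<close>

definition K :: "real \<Rightarrow> real" where "K r = (B1 r - (B r)\<^sup>2) / P r"
definition K1 :: "real \<Rightarrow> real" where
  "K1 r = (B2 r - 2 * B r * B1 r - (B r + r * B1 r) * K r) / P r"
definition M :: "real \<Rightarrow> real" where "M r = P r * B1 r + 2 * (B r)\<^sup>2"
definition M1 :: "real \<Rightarrow> real" where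
  "M1 r = (B r + r * B1 r) * B1 r + P r * B2 r + 4 * B r * B1 r"

text \<open>The Christoffel symbols in closed form. Being explicit, they only have to be checked
  against the Koszul formula, without inverting the metric.\<close>

definition Gam :: "'a \<Rightarrow> 'a \<Rightarrow> 'a \<Rightarrow> 'a" where
  "Gam x u v =
     - (K (x \<bullet> x) * (x \<bullet> u) * (x \<bullet> v) + B (x \<bullet> x) * (u \<bullet> v) + M (x \<bullet> x) * (j x \<bullet> u) * (j x \<bullet> v)) *\<^sub>R x
     + (K (x \<bullet> x) * ((x \<bullet> u) * (j x \<bullet> v) + (x \<bullet> v) * (j x \<bullet> u))) *\<^sub>R j x
     + B (x \<bullet> x) *\<^sub>R ((j x \<bullet> v) *\<^sub>R j u + (j x \<bullet> u) *\<^sub>R j v)"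

definition theta :: "'a \<Rightarrow> 'a \<Rightarrow> 'a \<Rightarrow> real" where
  "theta x u v = (x \<bullet> u) * (x \<bullet> v) / P (x \<bullet> x) + P (x \<bullet> x) * (j x \<bullet> u) * (j x \<bullet> v)"

definition nu :: "'a \<Rightarrow> 'a \<Rightarrow> 'a \<Rightarrow> real" where
  "nu x u v = (x \<bullet> u) * (j x \<bullet> v) - (j x \<bullet> u) * (x \<bullet> v)"

definition om :: "'a \<Rightarrow> 'a \<Rightarrow> real" where "om u v = j u \<bullet> v"

section \<open>Algebra of the metric and of the two complex structures\<close>

sublocale j: linear j by (fact j_linear)

lemma j_adj: "u \<bullet> j v = - (j u \<bullet> v)"
  using j_isometry[of u "j v"] by (simp add: j_j)

lemma om_sym: "j v \<bullet> u = - (j u \<bullet> v)"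
  by (metis inner_commute j_adj)

lemma j_self [simp]: "j x \<bullet> x = 0"
  using om_sym[of x x] by simp

lemma bounded_linear_j: "bounded_linear j"
  using j_linear by (rule linear_conv_bounded_linear[THEN iffD1])

lemmas has_derivative_j [derivative_intros] = bounded_linear.has_derivative[OF bounded_linear_j]

lemma open_U: "open U"
proof -
  have "open ((\<lambda>x. x \<bullet> x) -` T)"
    by (intro open_vimage[OF open_T] continuous_intros)
  then show ?thesis by (simp add: U_def vimage_def)
qed

lemma P_pos: "x \<in> U \<Longrightarrow> 0 < P (x \<bullet> x)"
  by (simp add: U_def P_def P_pos')

lemma sq_pos: "x \<in> U \<Longrightarrow> 0 < x \<bullet> x"
  using T_pos by (simp add: U_def del: inner_gt_zero_iff)

lemma g_U: "x \<in> U \<Longrightarrow> g x u v =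
    u \<bullet> v - B (x \<bullet> x) / P (x \<bullet> x) * (x \<bullet> u) * (x \<bullet> v) + B (x \<bullet> x) * (j x \<bullet> u) * (j x \<bullet> v)"
  by (simp add: U_def P_def g_eq)

lemma J_U: "x \<in> U \<Longrightarrow> J x u =
    j u - (B (x \<bullet> x) / P (x \<bullet> x) * (x \<bullet> u)) *\<^sub>R j x - (B (x \<bullet> x) * (j x \<bullet> u)) *\<^sub>R x"
  by (simp add: U_def P_def J_eq)

lemma g_sym: "x \<in> U \<Longrightarrow> g x u v = g x v u"
  by (simp add: g_U inner_commute)

lemma g_add_left: "x \<in> U \<Longrightarrow> g x (u + u') v = g x u v + g x u' v"
  by (simp add: g_U inner_add_left inner_add_right add_divide_distrib algebra_simps)

lemma g_scale_left: "x \<in> U \<Longrightarrow> g x (a *\<^sub>R u) v = a * g x u v"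
  by (simp add: g_U inner_add_left inner_add_right algebra_simps)

lemma g_minus_left: "x \<in> U \<Longrightarrow> g x (- u) v = - g x u v"
  using g_scale_left[of x "-1" u v] by simp

lemma g_diff_left: "x \<in> U \<Longrightarrow> g x (u - u') v = g x u v - g x u' v"
  using g_add_left[of x u "-u'" v] by (simp add: g_minus_left)

lemmas g_left = g_add_left g_scale_left g_minus_left g_diff_left

lemma
  assumes "x \<in> U"
  shows g_add_right: "g x u (v + v') = g x u v + g x u v'"
    and g_scale_right: "g x u (a *\<^sub>R v) = a * g x u v"
    and g_minus_right: "g x u (- v) = - g x u v"
  using g_left[OF assms] g_sym[OF assms] by metis+

lemmas g_right = g_add_right g_scale_right g_minus_right

lemma bilinear_g: "x \<in> U \<Longrightarrow> bilinear (g x)"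
  unfolding bilinear_def
  by (intro conjI allI linearI) (simp_all add: g_left g_right)

text \<open>A square root of the metric with respect to the Euclidean inner product.\<close>

definition stretch :: "real \<Rightarrow> real \<Rightarrow> 'a \<Rightarrow> 'a \<Rightarrow> 'a" where
  "stretch a b x u = u + (a * (x \<bullet> u)) *\<^sub>R x + (b * (j x \<bullet> u)) *\<^sub>R j x"

lemma linear_stretch: "linear (stretch a b x)"
  by (intro linearI) (simp_all add: stretch_def inner_add_right algebra_simps)

lemma
  shows x_stretch: "x \<bullet> stretch a b x u = (1 + a * (x \<bullet> x)) * (x \<bullet> u)"
    and jx_stretch: "j x \<bullet> stretch a b x u = (1 + b * (x \<bullet> x)) * (j x \<bullet> u)"
  by (simp_all add: stretch_def inner_add_right j_adj[of x] j_isometry[of x x] algebra_simps)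

text \<open>\<open>stretch a b x\<close> scales \<open>x\<close> by
  \<open>1 + a * (x \<bullet> x)\<close> and \<open>j x\<close> by
  \<open>1 + b * (x \<bullet> x)\<close>; the assumption makes these factors reciprocal.\<close>

lemma stretch_inverse:
  assumes ab: "a + b + a * b * (x \<bullet> x) = 0"
  shows "stretch b a x (stretch a b x u) = u"
proof -
  have "stretch b a x (stretch a b x u) = stretch a b x u
      + (b * ((1 + a * (x \<bullet> x)) * (x \<bullet> u))) *\<^sub>R x + (a * ((1 + b * (x \<bullet> x)) * (j x \<bullet> u))) *\<^sub>R j x"
    by (subst (1) stretch_def) (simp add: x_stretch jx_stretch)
  also have "\<dots> = u + ((a + b + a * b * (x \<bullet> x)) * (x \<bullet> u)) *\<^sub>R x
      + ((a + b + a * b * (x \<bullet> x)) * (j x \<bullet> u)) *\<^sub>R j x"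
    by (simp add: stretch_def algebra_simps)
  finally show ?thesis by (simp add: ab)
qed

lemma stretch_inner:
  "stretch a b x u \<bullet> stretch a b x v = u \<bullet> v + (2 * a + a\<^sup>2 * (x \<bullet> x)) * (x \<bullet> u) * (x \<bullet> v)
      + (2 * b + b\<^sup>2 * (x \<bullet> x)) * (j x \<bullet> u) * (j x \<bullet> v)"
proof -
  have "stretch a b x u \<bullet> stretch a b x v = u \<bullet> stretch a b x v
     + a * (x \<bullet> u) * (x \<bullet> stretch a b x v) + b * (j x \<bullet> u) * (j x \<bullet> stretch a b x v)"
    by (subst (1) stretch_def) (simp add: inner_add_left)
  also have "u \<bullet> stretch a b x v = u \<bullet> v + a * (x \<bullet> u) * (x \<bullet> v) + b * (j x \<bullet> u) * (j x \<bullet> v)"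
    by (simp add: stretch_def inner_add_right inner_commute[of u x] inner_commute[of u "j x"])
  finally show ?thesis
    by (simp add: x_stretch jx_stretch power2_eq_square algebra_simps)
qed

text \<open>The metric has the eigenvalue \<open>1 / P\<close> on \<open>x\<close>, \<open>P\<close>
  on \<open>j x\<close> and 1 on their orthogonal complement. The two coefficients give the scaling
  factors \<open>1 / sqrt P\<close> and \<open>sqrt P\<close>, so exchanging them inverts the
  root.\<close>

definition root_radial :: "'a \<Rightarrow> real" where
  "root_radial x = (1 / sqrt (P (x \<bullet> x)) - 1) / (x \<bullet> x)"
definition root_angular :: "'a \<Rightarrow> real" where
  "root_angular x = (sqrt (P (x \<bullet> x)) - 1) / (x \<bullet> x)"

lemma root_coeffs:
  assumes x: "x \<in> U"
  shows "root_radial x + root_angular x + root_radial x * root_angular x * (x \<bullet> x) = 0"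
    and "2 * root_radial x + (root_radial x)\<^sup>2 * (x \<bullet> x) = - (B (x \<bullet> x) / P (x \<bullet> x))"
    and "2 * root_angular x + (root_angular x)\<^sup>2 * (x \<bullet> x) = B (x \<bullet> x)"
proof -
  define r where "r = x \<bullet> x"
  define l where "l = sqrt (P r)"
  have r: "r > 0" and l: "l > 0" and lP: "P r = l\<^sup>2"
    using sq_pos[OF x] P_pos[OF x] by (auto simp: r_def l_def)
  have B: "B r = (l\<^sup>2 - 1) / r"
    using lP r by (simp add: P_def field_simps)
  have a: "root_radial x = (1 / l - 1) / r" and b: "root_angular x = (l - 1) / r"
    by (simp_all add: root_radial_def root_angular_def r_def l_def)
  show "root_radial x + root_angular x + root_radial x * root_angular x * (x \<bullet> x) = 0"
    "2 * root_radial x + (root_radial x)\<^sup>2 * (x \<bullet> x) = - (B (x \<bullet> x) / P (x \<bullet> x))"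
    "2 * root_angular x + (root_angular x)\<^sup>2 * (x \<bullet> x) = B (x \<bullet> x)"
    unfolding a b r_def[symmetric] B lP
    using r l by (simp_all add: field_simps power2_eq_square)
qed

abbreviation root :: "'a \<Rightarrow> 'a \<Rightarrow> 'a" where
  "root x \<equiv> stretch (root_radial x) (root_angular x) x"
abbreviation root_inv :: "'a \<Rightarrow> 'a \<Rightarrow> 'a" where
  "root_inv x \<equiv> stretch (root_angular x) (root_radial x) x"

lemma g_root: "x \<in> U \<Longrightarrow> g x u v = root x u \<bullet> root x v"
  by (simp add: stretch_inner g_U root_coeffs)

lemma
  assumes x: "x \<in> U"
  shows root_inv_root: "root_inv x (root x u) = u" and root_root_inv: "root x (root_inv x u) = u"
  using root_coeffs(1)[OF x] by (simp_all add: stretch_inverse algebra_simps)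

lemma g_pos:
  assumes x: "x \<in> U" and u: "u \<noteq> 0"
  shows "g x u u > 0"
proof -
  have "root x u \<noteq> 0"
    using root_inv_root[OF x, of u] u linear_0[OF linear_stretch] by metis
  then show ?thesis by (simp add: g_root[OF x])
qed

text \<open>\<open>root_inv\<close> carries the Euclidean orthonormal basis to one for
  \<open>g\<close>. This makes the choice of a basis in \<open>Ric\<close> and \<open>scal\<close>
  meaningful.\<close>

lemma orthonormal_basis_exists:
  assumes x: "x \<in> U"
  shows "\<exists>C. orthonormal_basis g x C"
proof -
  have inj: "root_inv x u = root_inv x v \<longleftrightarrow> u = v" for u v
    by (metis root_root_inv[OF x])
  have "span (root_inv x ` Basis) = range (root_inv x)"
    by (simp add: linear_span_image[OF linear_stretch])
  also have "\<dots> = UNIV" using root_inv_root[OF x] by (metis surjI)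
  finally show ?thesis
    unfolding orthonormal_basis_def
    by (intro exI[of _ "root_inv x ` Basis"])
      (auto simp: g_root[OF x] root_root_inv[OF x] inj inner_Basis)
qed

text \<open>Nondegeneracy, by testing with \<open>u - v\<close>.\<close>

lemma g_eqI:
  assumes "x \<in> U" "\<And>z. g x u z = g x v z"
  shows "u = v"
  using g_pos[of x "u - v"] assms by (force simp: g_left)

context
  fixes x assumes x: "x \<in> U"
begin

lemma
  shows P_ne: "P (x \<bullet> x) \<noteq> 0" and PB: "x \<bullet> x * B (x \<bullet> x) = P (x \<bullet> x) - 1"
  using P_pos[OF x] by (auto simp: P_def)

lemma g_x: "g x x z = (x \<bullet> z) / P (x \<bullet> x)"
proof -
  have "g x x z = (1 - x \<bullet> x * B (x \<bullet> x) / P (x \<bullet> x)) * (x \<bullet> z)"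
    by (simp add: g_U[OF x] algebra_simps)
  then show ?thesis using P_ne by (simp add: PB diff_divide_distrib)
qed

lemma g_jx: "g x (j x) z = P (x \<bullet> x) * (j x \<bullet> z)"
  by (simp add: g_U[OF x] j_isometry[of x x] j_adj[of x x] P_def algebra_simps)

lemma g_j: "g x (j u) z = om u z + B (x \<bullet> x) / P (x \<bullet> x) * (j x \<bullet> u) * (x \<bullet> z)
    + B (x \<bullet> x) * (x \<bullet> u) * (j x \<bullet> z)"
  by (simp add: g_U[OF x] om_def j_isometry[of x u] j_adj[of x u] algebra_simps)

text \<open>The Kaehler form is the constant Euclidean form \<open>om\<close>; identities for
  \<open>J\<close> are therefore reduced to identities for \<open>om\<close>.\<close>

lemma g_J: "g x (J x u) z = om u z"
proof -
  have "g x (J x u) z = om u z + B (x \<bullet> x) * (x \<bullet> u) * (j x \<bullet> z) * (1 - P (x \<bullet> x) / P (x \<bullet> x))"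
    by (simp add: J_U[OF x] g_left[OF x] g_x g_jx[of z] g_j[of u z] algebra_simps)
  then show ?thesis using P_ne by simp
qed

lemma om_swap: "om v u = - om u v"
  by (simp add: om_def om_sym[of v u])

lemma x_J: "x \<bullet> J x u = - P (x \<bullet> x) * (j x \<bullet> u)"
  using PB by (simp add: J_U[OF x] inner_diff_right j_adj[of x] P_def algebra_simps)

lemma jx_J: "j x \<bullet> J x u = (x \<bullet> u) / P (x \<bullet> x)"
proof -
  have "j x \<bullet> J x u = (x \<bullet> u) * (1 - x \<bullet> x * B (x \<bullet> x) / P (x \<bullet> x))"
    by (simp add: J_U[OF x] inner_diff_right j_isometry algebra_simps)
  then show ?thesis using P_ne by (simp add: PB diff_divide_distrib)
qed

lemma linear_J: "linear (J x)"
  by (intro linearI)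
    (simp_all add: J_U[OF x] j.add j.scaleR inner_add_right add_divide_distrib algebra_simps)

lemma om_J: "om (J x u) z = - g x u z"
  by (simp add: om_def J_U[OF x] j.diff j.scaleR j_j g_U[OF x] inner_diff_left)

lemma J_J: "J x (J x u) = - u"
  by (rule g_eqI[OF x]) (simp add: g_J om_J g_left[OF x])

lemma g_J_J: "g x (J x u) (J x v) = g x u v"
  using om_J[of v u] by (simp add: g_J om_swap[of u] g_sym[OF x, of u])

lemma theta_J: "theta x (J x u) v = nu x u v"
  using P_ne by (simp add: theta_def nu_def x_J jx_J algebra_simps)

lemma nu_J: "nu x u (J x v) = theta x u v"
  using P_ne by (simp add: theta_def nu_def x_J jx_J algebra_simps)

end

section \<open>Derivatives of the coefficients, the Levi-Civita connection and the curvature\<close>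

lemma
  assumes r: "r \<in> T"
  shows DBP: "((\<lambda>r. B r / P r) has_real_derivative K r / P r) (at r)"
    and DK: "(K has_real_derivative K1 r) (at r)"
    and DM: "(M has_real_derivative M1 r) (at r)"
proof -
  note D = DB[OF r] DB1[OF r]
  have ne: "P r \<noteq> 0" using P_pos'[OF r] by (simp add: P_def)
  have DP: "(P has_real_derivative B r + r * B1 r) (at r)"
    unfolding P_def[abs_def] by (rule derivative_eq_intros D refl)+ simp
  show "((\<lambda>r. B r / P r) has_real_derivative K r / P r) (at r)"
    by (rule derivative_eq_intros D DP refl ne)+
       (use ne in \<open>simp add: K_def field_simps\<close>, simp add: P_def power2_eq_square algebra_simps)
  show "(K has_real_derivative K1 r) (at r)"
    unfolding K_def[abs_def]
    by (rule derivative_eq_intros D DP refl ne)+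
       (use ne in \<open>simp add: K1_def K_def field_simps power2_eq_square\<close>)
  show "(M has_real_derivative M1 r) (at r)"
    unfolding M_def[abs_def]
    by (rule derivative_eq_intros D DP refl ne)+ (simp add: M1_def algebra_simps)
qed

lemma g_has_derivative:
  assumes x: "x \<in> U"
  shows "((\<lambda>a. g a u v) has_derivative (\<lambda>w.
     - (2 * K (x \<bullet> x) / P (x \<bullet> x) * (x \<bullet> w) * (x \<bullet> u) * (x \<bullet> v))
     - B (x \<bullet> x) / P (x \<bullet> x) * ((w \<bullet> u) * (x \<bullet> v) + (x \<bullet> u) * (w \<bullet> v))
     + 2 * B1 (x \<bullet> x) * (x \<bullet> w) * (j x \<bullet> u) * (j x \<bullet> v)
     + B (x \<bullet> x) * (om w u * (j x \<bullet> v) + (j x \<bullet> u) * om w v))) (at x)"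
proof -
  have r: "x \<bullet> x \<in> T" using x by (simp add: U_def)
  note D = has_derivative_radial[OF DBP[OF r]] has_derivative_radial[OF DB[OF r]]
  show ?thesis
    by (rule has_derivative_transform_within_open[OF _ open_U x,
        of "\<lambda>x. u \<bullet> v - B (x \<bullet> x) / P (x \<bullet> x) * (x \<bullet> u) * (x \<bullet> v) + B (x \<bullet> x) * (j x \<bullet> u) * (j x \<bullet> v)"])
     (rule derivative_eq_intros D refl ext | simp add: g_U om_def algebra_simps)+
qed

definition DGam :: "'a \<Rightarrow> 'a \<Rightarrow> 'a \<Rightarrow> 'a \<Rightarrow> 'a" where
  "DGam x w u v =
     - (K (x \<bullet> x) * (x \<bullet> u) * (x \<bullet> v) + B (x \<bullet> x) * (u \<bullet> v) + M (x \<bullet> x) * (j x \<bullet> u) * (j x \<bullet> v)) *\<^sub>R w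
     - (2 * K1 (x \<bullet> x) * (x \<bullet> w) * (x \<bullet> u) * (x \<bullet> v)
        + K (x \<bullet> x) * ((w \<bullet> u) * (x \<bullet> v) + (x \<bullet> u) * (w \<bullet> v))
        + 2 * B1 (x \<bullet> x) * (x \<bullet> w) * (u \<bullet> v)
        + 2 * M1 (x \<bullet> x) * (x \<bullet> w) * (j x \<bullet> u) * (j x \<bullet> v)
        + M (x \<bullet> x) * (om w u * (j x \<bullet> v) + (j x \<bullet> u) * om w v)) *\<^sub>R x
     + (K (x \<bullet> x) * ((x \<bullet> u) * (j x \<bullet> v) + (x \<bullet> v) * (j x \<bullet> u))) *\<^sub>R j w
     + (2 * K1 (x \<bullet> x) * (x \<bullet> w) * ((x \<bullet> u) * (j x \<bullet> v) + (x \<bullet> v) * (j x \<bullet> u))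
        + K (x \<bullet> x) * ((w \<bullet> u) * (j x \<bullet> v) + (x \<bullet> u) * om w v
                      + (w \<bullet> v) * (j x \<bullet> u) + (x \<bullet> v) * om w u)) *\<^sub>R j x
     + (2 * B1 (x \<bullet> x) * (x \<bullet> w)) *\<^sub>R ((j x \<bullet> v) *\<^sub>R j u + (j x \<bullet> u) *\<^sub>R j v)
     + B (x \<bullet> x) *\<^sub>R (om w v *\<^sub>R j u + om w u *\<^sub>R j v)"

lemma x_Gam: "x \<bullet> Gam x v w = x \<bullet> x *
      - (K (x \<bullet> x) * (x \<bullet> v) * (x \<bullet> w) + B (x \<bullet> x) * (v \<bullet> w) + M (x \<bullet> x) * (j x \<bullet> v) * (j x \<bullet> w))
    - 2 * B (x \<bullet> x) * (j x \<bullet> v) * (j x \<bullet> w)"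
  by (simp add: Gam_def inner_add_right inner_diff_right j_adj[of x] algebra_simps)

lemma jx_Gam: "j x \<bullet> Gam x v w = x \<bullet> x *
      (K (x \<bullet> x) * ((x \<bullet> v) * (j x \<bullet> w) + (x \<bullet> w) * (j x \<bullet> v)))
    + B (x \<bullet> x) * ((j x \<bullet> w) * (x \<bullet> v) + (j x \<bullet> v) * (x \<bullet> w))"
  by (simp add: Gam_def inner_add_right inner_diff_right j_isometry algebra_simps)

lemma inner_Gam: "u \<bullet> Gam x v w =
    - (K (x \<bullet> x) * (x \<bullet> v) * (x \<bullet> w) + B (x \<bullet> x) * (v \<bullet> w) + M (x \<bullet> x) * (j x \<bullet> v) * (j x \<bullet> w)) * (x \<bullet> u)
    + K (x \<bullet> x) * ((x \<bullet> v) * (j x \<bullet> w) + (x \<bullet> w) * (j x \<bullet> v)) * (j x \<bullet> u)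
    - B (x \<bullet> x) * ((j x \<bullet> w) * om u v + (j x \<bullet> v) * om u w)"
  by (simp add: Gam_def inner_add_right inner_diff_right j_adj[of u v] j_adj[of u w] om_def
     inner_commute[of u x] inner_commute[of u "j x"] algebra_simps)

lemma Gam_has_derivative:
  assumes x: "x \<in> U"
  shows "((\<lambda>a. Gam a u v) has_derivative (\<lambda>w. DGam x w u v)) (at x)"
proof -
  have r: "x \<bullet> x \<in> T" using x by (simp add: U_def)
  note D = has_derivative_radial[OF DK[OF r]] has_derivative_radial[OF DB[OF r]]
    has_derivative_radial[OF DM[OF r]]
  show ?thesis
    unfolding Gam_def DGam_def
    by (rule derivative_eq_intros D refl ext | simp add: om_def algebra_simps)+
qed

context
  fixes x assumes x: "x \<in> U"
begin

text \<open>Replaces \<open>x \<bullet> u\<close>, which is \<open>P\<close> times this form, so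
  that the metric and the connection become polynomial in the remaining quantities.\<close>

definition ga :: "'a \<Rightarrow> real" where "ga u = (x \<bullet> u) / P (x \<bullet> x)"

lemma x_ga: "x \<bullet> u = P (x \<bullet> x) * ga u"
  using P_ne[OF x] by (simp add: ga_def)

lemma g_x_ga: "g x x z = ga z"
  by (simp add: g_x[OF x] ga_def)

lemma g_j_ga: "g x (j u) z = om u z + B (x \<bullet> x) * (j x \<bullet> u) * ga z
    + B (x \<bullet> x) * P (x \<bullet> x) * ga u * (j x \<bullet> z)"
  using P_ne[OF x] by (simp add: g_j[OF x, of u z] ga_def)

lemma inner_ga: "u \<bullet> v = g x u v + B (x \<bullet> x) * P (x \<bullet> x) * ga u * ga v - B (x \<bullet> x) * (j x \<bullet> u) * (j x \<bullet> v)"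
  using P_ne[OF x] by (simp add: g_U[OF x] ga_def)

lemma theta_ga: "theta x u v = P (x \<bullet> x) * (ga u * ga v + (j x \<bullet> u) * (j x \<bullet> v))"
  using P_ne[OF x] by (simp add: theta_def ga_def distrib_left)

lemma B1_K: "B1 (x \<bullet> x) = P (x \<bullet> x) * K (x \<bullet> x) + (B (x \<bullet> x))\<^sup>2"
  using P_ne[OF x] by (simp add: K_def)

lemma g_Gam: "g x (Gam x u v) z =
    - (K (x \<bullet> x) * (x \<bullet> u) * (x \<bullet> v) + B (x \<bullet> x) * (u \<bullet> v) + M (x \<bullet> x) * (j x \<bullet> u) * (j x \<bullet> v)) * ga z
     + (K (x \<bullet> x) * ((x \<bullet> u) * (j x \<bullet> v) + (x \<bullet> v) * (j x \<bullet> u))) * (P (x \<bullet> x) * (j x \<bullet> z))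
     + B (x \<bullet> x) * ((j x \<bullet> v) * g x (j u) z + (j x \<bullet> u) * g x (j v) z)"
  by (simp add: Gam_def g_left[OF x] g_x_ga g_jx[OF x])

lemma g_j_Gam: "g x (j (Gam x v w)) z =
    - (K (x \<bullet> x) * (x \<bullet> v) * (x \<bullet> w) + B (x \<bullet> x) * (v \<bullet> w) + M (x \<bullet> x) * (j x \<bullet> v) * (j x \<bullet> w))
      * (P (x \<bullet> x) * (j x \<bullet> z))
    - K (x \<bullet> x) * ((x \<bullet> v) * (j x \<bullet> w) + (x \<bullet> w) * (j x \<bullet> v)) * ga z
    - B (x \<bullet> x) * ((j x \<bullet> w) * g x v z + (j x \<bullet> v) * g x w z)"
  by (simp add: Gam_def j.add j.diff j.neg j.scaleR j_j g_left[OF x] g_x_ga g_jx[OF x] algebra_simps)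

text \<open>Once \<open>x_ga\<close> and \<open>B1_K\<close> have removed the denominators, both
  sides agree as polynomials.\<close>

lemma koszul: "2 * g x (Gam x u v) z =
   Dir (\<lambda>a. g a v z) x u + Dir (\<lambda>a. g a u z) x v - Dir (\<lambda>a. g a u v) x z"
proof -
  have 1: "Dir (\<lambda>a. g a u v) x w =
     - (2 * K (x \<bullet> x) * P (x \<bullet> x) * P (x \<bullet> x) * ga w * ga u * ga v)
     - B (x \<bullet> x) * ((w \<bullet> u) * ga v + ga u * (w \<bullet> v))
     + 2 * B1 (x \<bullet> x) * P (x \<bullet> x) * ga w * (j x \<bullet> u) * (j x \<bullet> v)
     + B (x \<bullet> x) * (om w u * (j x \<bullet> v) + (j x \<bullet> u) * om w v)" for u v w
    using P_ne[OF x]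
    by (simp add: frechet_derivative_at[OF g_has_derivative[OF x], symmetric] ga_def distrib_left
        add_divide_distrib)
  show ?thesis
    unfolding 1 g_Gam g_j_ga x_ga[of u] x_ga[of v] M_def B1_K om_swap[OF x, of u z] om_swap[OF x, of v z] om_swap[OF x, of v u]
      inner_commute[of v u] inner_commute[of z u] inner_commute[of z v]
    by algebra
qed

end

text \<open>\<open>koszul\<close> shows that \<open>Gam\<close> meets the defining condition, and
  \<open>g_eqI\<close> that nothing else does.\<close>

lemma christoffel_eq:
  assumes x: "x \<in> U"
  shows "christoffel g x u v = Gam x u v"
  unfolding christoffel_def koszul[OF x, symmetric]
  by (rule the_equality) (auto intro: g_eqI[OF x])

lemma Gam_0: "Gam x 0 v = 0"
  by (simp add: Gam_def j.zero)

lemma nabla_const: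
  assumes x: "x \<in> U"
  shows "nabla g X (\<lambda>_. v) x = Gam x (X x) v"
  by (simp add: nabla_def christoffel_eq[OF x])

lemma nabla_nabla:
  assumes x: "x \<in> U"
  shows "nabla g (\<lambda>_. u) (nabla g (\<lambda>_. v) (\<lambda>_. w)) x = DGam x u v w + Gam x u (Gam x v w)"
proof -
  have "(nabla g (\<lambda>_. v) (\<lambda>_. w) has_derivative (\<lambda>u. DGam x u v w)) (at x)"
    by (rule has_derivative_transform_within_open[OF Gam_has_derivative[OF x] open_U x])
      (simp add: nabla_const)
  from frechet_derivative_at[OF this] show ?thesis
    unfolding nabla_def[of g _ "nabla g (\<lambda>_. v) (\<lambda>_. w)"]
    by (metis nabla_const[OF x] christoffel_eq[OF x])
qed

text \<open>The Lie bracket of constant fields is zero, so the third term of the curvature is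
  \<open>Gam x 0 w = 0\<close>.\<close>

lemma curvature_op_eq:
  assumes x: "x \<in> U"
  shows "curvature_op g (\<lambda>_. u) (\<lambda>_. v) (\<lambda>_. w) x =
    (DGam x u v w + Gam x u (Gam x v w)) - (DGam x v u w + Gam x v (Gam x u w))"
  by (simp add: curvature_op_def nabla_nabla[OF x] nabla_const[OF x] lie_bracket_def Gam_0)

lemma Riem_eq:
  assumes x: "x \<in> U"
  shows "Riem g x u v w z = - B (x \<bullet> x) * kulkarni (g x) om (g x) om u v w z
     - B1 (x \<bullet> x) * (kulkarni (g x) om (theta x) (nu x) u v w z + kulkarni (theta x) (nu x) (g x) om u v w z)
     + 2 * B2 (x \<bullet> x) * nu x u v * nu x w z"
proof -
  note ga = g_x_ga[OF x] g_jx[OF x]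
  \<comment> \<open>\<open>G\<close> is an arbitrary vector; its products with the other vectors
    stay open here and are supplied later by \<open>x_Gam\<close>, \<open>jx_Gam\<close>,
    \<open>inner_Gam\<close> and \<open>g_j_Gam\<close>.\<close>
  have S: "g x (DGam x u v w + Gam x u G) z =
    - (2 * K1 (x \<bullet> x) * (x \<bullet> u) * (x \<bullet> v) * (x \<bullet> w)
       + K (x \<bullet> x) * (u \<bullet> v * (x \<bullet> w) + (x \<bullet> v) * (u \<bullet> w)) + 2 * B1 (x \<bullet> x) * (x \<bullet> u) * (v \<bullet> w)
       + 2 * M1 (x \<bullet> x) * (x \<bullet> u) * (j x \<bullet> v) * (j x \<bullet> w)
       + M (x \<bullet> x) * (om u v * (j x \<bullet> w) + (j x \<bullet> v) * om u w)) * ga x z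
     + - (K (x \<bullet> x) * (x \<bullet> v) * (x \<bullet> w) + B (x \<bullet> x) * (v \<bullet> w) + M (x \<bullet> x) * (j x \<bullet> v) * (j x \<bullet> w)) * g x u z
     + (2 * K1 (x \<bullet> x) * (x \<bullet> u) * ((x \<bullet> v) * (j x \<bullet> w) + (x \<bullet> w) * (j x \<bullet> v))
       + K (x \<bullet> x) * (u \<bullet> v * (j x \<bullet> w) + (x \<bullet> v) * om u w + u \<bullet> w * (j x \<bullet> v) + (x \<bullet> w) * om u v))
       * (P (x \<bullet> x) * (j x \<bullet> z))
     + K (x \<bullet> x) * ((x \<bullet> v) * (j x \<bullet> w) + (x \<bullet> w) * (j x \<bullet> v)) * g x (j u) z
     + 2 * B1 (x \<bullet> x) * (x \<bullet> u) * ((j x \<bullet> w) * g x (j v) z + (j x \<bullet> v) * g x (j w) z)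
     + B (x \<bullet> x) * (om u w * g x (j v) z + om u v * g x (j w) z)
     + (- (K (x \<bullet> x) * (x \<bullet> u) * (x \<bullet> G) + B (x \<bullet> x) * (u \<bullet> G) + M (x \<bullet> x) * (j x \<bullet> u) * (j x \<bullet> G))) * ga x z
     + K (x \<bullet> x) * ((x \<bullet> u) * (j x \<bullet> G) + (x \<bullet> G) * (j x \<bullet> u)) * (P (x \<bullet> x) * (j x \<bullet> z))
     + B (x \<bullet> x) * ((j x \<bullet> G) * g x (j u) z + (j x \<bullet> u) * g x (j G) z)" for u v w G
    by (simp add: DGam_def g_left[OF x] ga g_Gam[OF x] algebra_simps)
  have B2: "B2 (x \<bullet> x) = (B (x \<bullet> x) + x \<bullet> x * B1 (x \<bullet> x)) * K (x \<bullet> x) + P (x \<bullet> x) * K1 (x \<bullet> x)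
      + 2 * B (x \<bullet> x) * B1 (x \<bullet> x)"
    using P_ne[OF x] by (simp add: K1_def)
  \<comment> \<open>The scalar products of the vectors become variables of \<open>riem_alg\<close>.
    Primes on \<open>B\<close>, \<open>k\<close>, \<open>m\<close>, \<open>p\<close> mark
    derivatives; the other primed letters belong to the term with \<open>u\<close> and
    \<open>v\<close> exchanged.\<close>
  note R = riem_alg[where \<rho> = "x \<bullet> x" and p = "P (x \<bullet> x)"
        and B = "B (x \<bullet> x)" and B' = "B1 (x \<bullet> x)" and B'' = "B2 (x \<bullet> x)"
        and k = "K (x \<bullet> x)" and k' = "K1 (x \<bullet> x)" and m = "M (x \<bullet> x)"
        and m' = "M1 (x \<bullet> x)"
        and p' = "B (x \<bullet> x) + x \<bullet> x * B1 (x \<bullet> x)" and au = "x \<bullet> u"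
        and bu = "j x \<bullet> u" and cu = "ga x u" and av = "x \<bullet> v"
        and bv = "j x \<bullet> v" and cv = "ga x v" and aw = "x \<bullet> w"
        and bw = "j x \<bullet> w" and cw = "ga x w" and az = "x \<bullet> z"
        and bz = "j x \<bullet> z" and cz = "ga x z" and nuv = "u \<bullet> v"
        and nuw = "u \<bullet> w" and nvw = "v \<bullet> w" and guw = "g x u w"
        and gvw = "g x v w" and guz = "g x u z" and gvz = "g x v z" and gwz = "g x w z"
        and guv = "g x u v" and ouv = "om u v" and ovu = "om v u" and ouw = "om u w"
        and ovw = "om v w" and ouz = "om u z" and ovz = "om v z" and owz = "om w z"
        and giuz = "g x (j u) z" and givz = "g x (j v) z" and giwz = "g x (j w) z"
        and P = "- (K (x \<bullet> x) * (x \<bullet> v) * (x \<bullet> w) + B (x \<bullet> x) * (v \<bullet> w) + M (x \<bullet> x) * (j x \<bullet> v) * (j x \<bullet> w))"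
        and Q = "K (x \<bullet> x) * ((x \<bullet> v) * (j x \<bullet> w) + (x \<bullet> w) * (j x \<bullet> v))"
        and P' = "- (K (x \<bullet> x) * (x \<bullet> u) * (x \<bullet> w) + B (x \<bullet> x) * (u \<bullet> w) + M (x \<bullet> x) * (j x \<bullet> u) * (j x \<bullet> w))"
        and Q' = "K (x \<bullet> x) * ((x \<bullet> u) * (j x \<bullet> w) + (x \<bullet> w) * (j x \<bullet> u))"
        and aG = "x \<bullet> Gam x v w" and bG = "j x \<bullet> Gam x v w"
        and nuG = "u \<bullet> Gam x v w" and giGz = "g x (j (Gam x v w)) z"
        and aG' = "x \<bullet> Gam x u w" and bG' = "j x \<bullet> Gam x u w"
        and nvG' = "v \<bullet> Gam x u w" and giGz' = "g x (j (Gam x u w)) z"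
        and S = "g x (DGam x u v w + Gam x u (Gam x v w)) z"
        and S' = "g x (DGam x v u w + Gam x v (Gam x u w)) z",
      OF P_def B1_K[OF x] M_def refl B2 M1_def
      x_ga[OF x] x_ga[OF x] x_ga[OF x] x_ga[OF x] inner_ga[OF x] inner_ga[OF x] inner_ga[OF x]
      g_j_ga[OF x] g_j_ga[OF x] g_j_ga[OF x] refl refl refl refl S
      om_swap[OF x] S[of v u w, unfolded inner_commute[of v u]]
      x_Gam jx_Gam inner_Gam g_j_Gam[OF x] x_Gam jx_Gam
      inner_Gam g_j_Gam[OF x]]
  show ?thesis
    unfolding Riem_def curvature_op_eq[OF x] g_diff_left[OF x] kulkarni_def theta_ga[OF x] nu_def
    by (rule trans[OF R]) (simp add: algebra_simps)
qed

lemma J_has_derivative: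
  assumes x: "x \<in> U"
  shows "((\<lambda>a. J a v) has_derivative (\<lambda>w.
     - (2 * K (x \<bullet> x) / P (x \<bullet> x) * (x \<bullet> w) * (x \<bullet> v) + B (x \<bullet> x) / P (x \<bullet> x) * (w \<bullet> v)) *\<^sub>R j x
     - (B (x \<bullet> x) / P (x \<bullet> x) * (x \<bullet> v)) *\<^sub>R j w
     - (2 * B1 (x \<bullet> x) * (x \<bullet> w) * (j x \<bullet> v) + B (x \<bullet> x) * om w v) *\<^sub>R x
     - (B (x \<bullet> x) * (j x \<bullet> v)) *\<^sub>R w)) (at x)"
proof -
  have r: "x \<bullet> x \<in> T" using x by (simp add: U_def)
  note D = has_derivative_radial[OF DBP[OF r]] has_derivative_radial[OF DB[OF r]]
  show ?thesis
    by (rule has_derivative_transform_within_open[OF _ open_U x,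
        of "\<lambda>x. j v - (B (x \<bullet> x) / P (x \<bullet> x) * (x \<bullet> v)) *\<^sub>R j x - (B (x \<bullet> x) * (j x \<bullet> v)) *\<^sub>R x"])
     (rule derivative_eq_intros D refl ext | simp add: J_U om_def algebra_simps)+
qed

text \<open>Tested against \<open>z\<close>, the right side is \<open>om (Gam x u v) z\<close> by
  \<open>g_J\<close>, and the left side is the derivative of \<open>J\<close> plus
  \<open>Gam x u (J x v)\<close>. Without denominators this is a polynomial identity.\<close>

lemma nabla_J:
  assumes x: "x \<in> U"
  shows "nabla g (\<lambda>_. u) (\<lambda>q. J q v) x = J x (nabla g (\<lambda>_. u) (\<lambda>_. v) x)"
proof (rule g_eqI[OF x])
  fix z
  note ga = g_x_ga[OF x] g_jx[OF x] g_left[OF x]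
  define D where "D = Dir (\<lambda>q. J q v) x u"
  have D: "g x D z =
      - (2 * K (x \<bullet> x) * (x \<bullet> u) * ga x v + B (x \<bullet> x) / P (x \<bullet> x) * (u \<bullet> v)) * (P (x \<bullet> x) * (j x \<bullet> z))
      - B (x \<bullet> x) * ga x v * g x (j u) z
      - (2 * B1 (x \<bullet> x) * (x \<bullet> u) * (j x \<bullet> v) + B (x \<bullet> x) * om u v) * ga x z
      - B (x \<bullet> x) * (j x \<bullet> v) * g x u z"
    unfolding D_def frechet_derivative_at[OF J_has_derivative[OF x], symmetric] ga
    by (simp add: ga_def[OF x])
  \<comment> \<open>The remaining denominator cancels against the factor \<open>P\<close> that
    \<open>g_jx\<close> contributes.\<close>
  also have "B (x \<bullet> x) / P (x \<bullet> x) * (u \<bullet> v) = B (x \<bullet> x) * (u \<bullet> v) / P (x \<bullet> x)" by simp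
  also have "- (2 * K (x \<bullet> x) * (x \<bullet> u) * ga x v + B (x \<bullet> x) * (u \<bullet> v) / P (x \<bullet> x)) * (P (x \<bullet> x) * (j x \<bullet> z))
     = - (2 * K (x \<bullet> x) * (x \<bullet> u) * ga x v * P (x \<bullet> x) + B (x \<bullet> x) * (u \<bullet> v)) * (j x \<bullet> z)"
    using P_ne[OF x] by (simp add: algebra_simps)
  finally have D': "g x D z = \<dots>
      - B (x \<bullet> x) * ga x v * g x (j u) z
      - (2 * B1 (x \<bullet> x) * (x \<bullet> u) * (j x \<bullet> v) + B (x \<bullet> x) * om u v) * ga x z
      - B (x \<bullet> x) * (j x \<bullet> v) * g x u z" .
  have uJ: "u \<bullet> J x v = - om u v - B (x \<bullet> x) * ga x v * (j x \<bullet> u) - B (x \<bullet> x) * (j x \<bullet> v) * (x \<bullet> u)"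
    by (simp add: J_U[OF x] inner_diff_right j_adj[of u v] om_def ga_def[OF x] inner_commute[of u x]
        inner_commute[of u "j x"])
  have jJ: "g x (j (J x v)) z = - g x v z + B (x \<bullet> x) * ga x v * ga x z
      - B (x \<bullet> x) * (j x \<bullet> v) * (P (x \<bullet> x) * (j x \<bullet> z))"
    by (simp add: J_U[OF x] j.diff j.scaleR j_j ga) (simp add: ga_def[OF x])
  have jxJ: "j x \<bullet> J x v = ga x v"
    by (simp add: jx_J[OF x] ga_def[OF x])
  have omG: "om (Gam x u v) z =
    - (K (x \<bullet> x) * (x \<bullet> u) * (x \<bullet> v) + B (x \<bullet> x) * (u \<bullet> v) + M (x \<bullet> x) * (j x \<bullet> u) * (j x \<bullet> v)) * (j x \<bullet> z)
     - (K (x \<bullet> x) * ((x \<bullet> u) * (j x \<bullet> v) + (x \<bullet> v) * (j x \<bullet> u))) * (x \<bullet> z)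
     - B (x \<bullet> x) * ((j x \<bullet> v) * (u \<bullet> z) + (j x \<bullet> u) * (v \<bullet> z))"
    by (simp add: om_def Gam_def j.add j.diff j.neg j.scaleR j_j inner_add_left inner_diff_left)
      (simp add: algebra_simps)
  have "g x (D + Gam x u (J x v)) z = om (Gam x u v) z"
    unfolding g_left[OF x] D' g_Gam[OF x] omG uJ jJ jxJ x_J[OF x] g_j_ga[OF x, of u z] inner_ga[OF x, of u v]
      inner_ga[OF x, of u z] inner_ga[OF x, of v z] x_ga[OF x, of u] x_ga[OF x, of v] x_ga[OF x, of z]
      M_def B1_K[OF x]
    by algebra
  then show "g x (nabla g (\<lambda>_. u) (\<lambda>q. J q v) x) z = g x (J x (nabla g (\<lambda>_. u) (\<lambda>_. v) x)) z"
    by (simp add: nabla_const[OF x] g_J[OF x]) (simp add: nabla_def D_def christoffel_eq[OF x])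
qed

section \<open>Traces over an orthonormal basis and the Ricci tensor\<close>

context
  fixes x C assumes x: "x \<in> U" and C: "orthonormal_basis g x C"
begin

lemma
  shows fin_C: "finite C" and span_C: "span C = UNIV"
    and ortho_C: "e \<in> C \<Longrightarrow> e' \<in> C \<Longrightarrow> g x e e' = (if e = e' then 1 else 0)"
  using C by (auto simp: orthonormal_basis_def)

lemma linear_g: "linear (\<lambda>a. g x a e)"
  by (intro linearI) (simp_all add: g_left[OF x])

lemma g_comb:
  assumes "e \<in> C"
  shows "g x (\<Sum>v\<in>C. c v *\<^sub>R v) e = c e"
proof -
  have "g x (\<Sum>v\<in>C. c v *\<^sub>R v) e = (\<Sum>v\<in>C. c v * g x v e)"
    by (simp add: linear_sum[OF linear_g] g_left[OF x])
  also have "\<dots> = (\<Sum>v\<in>C. if v = e then c e else 0)"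
    using assms by (intro sum.cong) (auto simp: ortho_C)
  finally show ?thesis using assms fin_C by simp
qed

text \<open>Pairing a vanishing combination with a member of \<open>C\<close> isolates its
  coefficient, so the spanning set \<open>C\<close> is independent.\<close>

lemma card_C: "card C = DIM('a)"
proof -
  have "independent C"
  proof
    assume "dependent C"
    then obtain c v where "v \<in> C" "c v \<noteq> 0" "(\<Sum>v\<in>C. c v *\<^sub>R v) = 0"
      by (auto simp: dependent_finite[OF fin_C])
    then show False
      using g_comb[of v c] linear_0[OF linear_g] by simp
  qed
  then show ?thesis
    using dim_eq_card[of C UNIV] span_C by simp
qed

text \<open>The coefficient of \<open>e\<close> in the expansion of \<open>a\<close> is
  \<open>g x a e\<close>.\<close>

lemma contract:
  assumes "linear f"
  shows "(\<Sum>e\<in>C. g x a e * f e) = f a"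
proof -
  have "a \<in> span C" by (simp add: span_C)
  then obtain c where c: "a = (\<Sum>v\<in>C. c v *\<^sub>R v)"
    by (auto simp: span_finite[OF fin_C])
  have "(\<Sum>e\<in>C. g x a e * f e) = (\<Sum>e\<in>C. c e * f e)"
    by (intro sum.cong) (auto simp: c g_comb)
  also have "\<dots> = f a"
    by (simp add: c linear_sum[OF assms] linear_scale[OF assms])
  finally show ?thesis .
qed

text \<open>Each form is a metric one: \<open>x \<bullet> e = P * g x x e\<close>,
  \<open>j x \<bullet> e = g x (j x) e / P\<close> and \<open>om a e = g x (J x a) e\<close>, so
  \<open>contract\<close> applies.\<close>

lemma
  assumes "linear f"
  shows contract_x: "(\<Sum>e\<in>C. (x \<bullet> e) * f e) = P (x \<bullet> x) * f x"
    and contract_jx: "(\<Sum>e\<in>C. (j x \<bullet> e) * f e) = f (j x) / P (x \<bullet> x)"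
    and contract_om: "(\<Sum>e\<in>C. om a e * f e) = f (J x a)"
proof -
  have "(\<Sum>e\<in>C. (x \<bullet> e) * f e) / P (x \<bullet> x) = f x"
    using contract[OF assms, of x] by (simp add: g_x[OF x] sum_divide_distrib)
  then show "(\<Sum>e\<in>C. (x \<bullet> e) * f e) = P (x \<bullet> x) * f x"
    using P_ne[OF x] by (simp add: field_simps)
  have "P (x \<bullet> x) * (\<Sum>e\<in>C. (j x \<bullet> e) * f e) = f (j x)"
    using contract[OF assms, of "j x"] by (simp add: g_jx[OF x] sum_distrib_left mult.assoc)
  then show "(\<Sum>e\<in>C. (j x \<bullet> e) * f e) = f (j x) / P (x \<bullet> x)"
    using P_ne[OF x] by (simp add: field_simps)
  show "(\<Sum>e\<in>C. om a e * f e) = f (J x a)"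
    using contract[OF assms, of "J x a"] by (simp add: g_J[OF x])
qed

lemma linear_forms:
  "linear (\<lambda>e. g x y e)" "linear (\<lambda>e. om y e)" "linear (\<lambda>e. theta x y e)" "linear (\<lambda>e. nu x y e)"
  by (intro linearI; simp add: g_right[OF x] om_def theta_def nu_def inner_add_right add_divide_distrib algebra_simps)+

lemma linear_inner: "linear (\<lambda>e. y \<bullet> e)"
  by (intro linearI) (simp_all add: inner_add_right)

text \<open>\<open>theta\<close> is \<open>x \<bullet> x\<close> times the metric on the real plane
  of \<open>x\<close> and \<open>j x\<close>, and zero on its complement.\<close>

lemma
  shows trace_g: "(\<Sum>e\<in>C. g x e e) = DIM('a)"
    and trace_theta: "(\<Sum>e\<in>C. theta x e e) = 2 * (x \<bullet> x)"
proof -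
  show "(\<Sum>e\<in>C. g x e e) = DIM('a)"
    by (simp add: ortho_C card_C)
  show "(\<Sum>e\<in>C. theta x e e) = 2 * (x \<bullet> x)"
    using contract_x[OF linear_inner[of x]] contract_jx[OF linear_inner[of "j x"]] P_ne[OF x]
    by (simp add: theta_def sum.distrib mult.assoc j_isometry flip: sum_distrib_left sum_divide_distrib)
qed

lemma om_self: "om e e = 0" and nu_self: "nu x e e = 0"
  using om_swap[OF x, of e e] by (simp_all add: nu_def)

lemma theta_sym: "theta x u v = theta x v u" and nu_swap: "nu x u v = - nu x v u"
  by (simp_all add: theta_def nu_def algebra_simps)

text \<open>The products of two forms that occur when the terms of \<open>Riem_eq\<close> are
  traced. Symmetry or skew symmetry moves the summation vector into the last slot, where
  \<open>contract\<close> and its variants apply.\<close>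

lemma contractions:
  "(\<Sum>e\<in>C. g x e z * g x y e) = g x y z"
  "(\<Sum>e\<in>C. g x e z * theta x y e) = theta x y z"
  "(\<Sum>e\<in>C. theta x e z * g x y e) = theta x y z"
  "(\<Sum>e\<in>C. om e z * om y e) = - g x y z"
  "(\<Sum>e\<in>C. om e z * nu x y e) = - theta x y z"
  "(\<Sum>e\<in>C. nu x e z * om y e) = - theta x y z"
  "(\<Sum>e\<in>C. nu x e z * nu x y e) = - (x \<bullet> x) * theta x y z"
proof -
  show "(\<Sum>e\<in>C. g x e z * g x y e) = g x y z" "(\<Sum>e\<in>C. g x e z * theta x y e) = theta x y z"
    using contract[OF linear_forms(1), of z y] contract[OF linear_forms(3), of z y]
    by (simp_all add: g_sym[OF x, of _ z])
  show "(\<Sum>e\<in>C. theta x e z * g x y e) = theta x y z"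
    using contract[OF linear_forms(3), of y z]
    by (simp add: theta_sym[of _ z] mult.commute)
  show "(\<Sum>e\<in>C. om e z * om y e) = - g x y z"
    using contract_om[OF linear_forms(2), of z y]
    by (simp add: om_swap[OF x, of _ z] sum_negf om_swap[OF x, of y "J x z"] om_J[OF x] g_sym[OF x, of z])
  show "(\<Sum>e\<in>C. om e z * nu x y e) = - theta x y z"
    using contract_om[OF linear_forms(4), of z y]
    by (simp add: om_swap[OF x, of _ z] sum_negf nu_J[OF x])
  show "(\<Sum>e\<in>C. nu x e z * om y e) = - theta x y z"
    using contract_om[OF linear_forms(4), of y z]
    by (simp add: nu_swap[of _ z] sum_negf mult.commute nu_J[OF x] theta_sym[of z])
  have "(\<Sum>e\<in>C. nu x e z * nu x y e) = (j x \<bullet> z) * (\<Sum>e\<in>C. (x \<bullet> e) * nu x y e) - (x \<bullet> z) * (\<Sum>e\<in>C. (j x \<bullet> e) * nu x y e)"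
    by (simp add: nu_def[of x _ z] algebra_simps sum_distrib_left sum_subtractf)
  also have "\<dots> = - (x \<bullet> x) * theta x y z"
    unfolding contract_x[OF linear_forms(4)] contract_jx[OF linear_forms(4)]
    by (simp add: nu_def theta_def j_isometry j_adj[of x x] algebra_simps)
  finally show "(\<Sum>e\<in>C. nu x e z * nu x y e) = - (x \<bullet> x) * theta x y z" .
qed

lemma sum_kulkarni: "(\<Sum>e\<in>C. kulkarni h \<omega> h' \<omega>' e y z e) =
    h y z * (\<Sum>e\<in>C. h' e e) - (\<Sum>e\<in>C. h e z * h' y e) + \<omega> y z * (\<Sum>e\<in>C. \<omega>' e e)
    - (\<Sum>e\<in>C. \<omega> e z * \<omega>' y e) - 2 * (\<Sum>e\<in>C. \<omega> e y * \<omega>' z e)"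
  by (simp add: kulkarni_def sum.distrib sum_subtractf sum_distrib_left mult.assoc)

lemma sum_Riem: "(\<Sum>e\<in>C. Riem g x e y z e) =
    - (B (x \<bullet> x) * (real DIM('a) + 2) + 2 * B1 (x \<bullet> x) * (x \<bullet> x)) * g x y z
    - (B1 (x \<bullet> x) * (real DIM('a) + 4) + 2 * B2 (x \<bullet> x) * (x \<bullet> x)) * theta x y z"
proof -
  have "(\<Sum>e\<in>C. Riem g x e y z e) = - B (x \<bullet> x) * (\<Sum>e\<in>C. kulkarni (g x) om (g x) om e y z e)
     - B1 (x \<bullet> x) * ((\<Sum>e\<in>C. kulkarni (g x) om (theta x) (nu x) e y z e) + (\<Sum>e\<in>C. kulkarni (theta x) (nu x) (g x) om e y z e))
     + 2 * B2 (x \<bullet> x) * (\<Sum>e\<in>C. nu x e y * nu x z e)"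
    by (simp add: Riem_eq[OF x] sum.distrib sum_subtractf sum_negf mult.assoc flip: sum_distrib_left)
  also have "\<dots> = - (B (x \<bullet> x) * (real DIM('a) + 2) + 2 * B1 (x \<bullet> x) * (x \<bullet> x)) * g x y z
    - (B1 (x \<bullet> x) * (real DIM('a) + 4) + 2 * B2 (x \<bullet> x) * (x \<bullet> x)) * theta x y z"
    by (simp add: sum_kulkarni contractions trace_g trace_theta om_self nu_self g_sym[OF x, of z y]
        theta_sym[of z y]) (simp add: algebra_simps)
  finally show ?thesis .
qed

end

text \<open>The basis chosen in the definitions is orthonormal because one exists, and
  \<open>sum_Riem\<close> gives the same value for every such basis.\<close>

lemma
  assumes x: "x \<in> U"
  shows Ric_eq: "Ric g x y z =
    - (B (x \<bullet> x) * (real DIM('a) + 2) + 2 * B1 (x \<bullet> x) * (x \<bullet> x)) * g x y z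
    - (B1 (x \<bullet> x) * (real DIM('a) + 4) + 2 * B2 (x \<bullet> x) * (x \<bullet> x)) * theta x y z"
    and scal_eq: "scal g x =
    - (B (x \<bullet> x) * (real DIM('a) + 2) + 2 * B1 (x \<bullet> x) * (x \<bullet> x)) * DIM('a)
    - (B1 (x \<bullet> x) * (real DIM('a) + 4) + 2 * B2 (x \<bullet> x) * (x \<bullet> x)) * (2 * (x \<bullet> x))"
proof -
  have C: "orthonormal_basis g x (SOME C. orthonormal_basis g x C)"
    using orthonormal_basis_exists[OF x] by (rule someI_ex)
  show Ric: "Ric g x y z =
    - (B (x \<bullet> x) * (real DIM('a) + 2) + 2 * B1 (x \<bullet> x) * (x \<bullet> x)) * g x y z
    - (B1 (x \<bullet> x) * (real DIM('a) + 4) + 2 * B2 (x \<bullet> x) * (x \<bullet> x)) * theta x y z" for y z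
    unfolding Ric_def by (rule sum_Riem[OF x C])
  show "scal g x =
    - (B (x \<bullet> x) * (real DIM('a) + 2) + 2 * B1 (x \<bullet> x) * (x \<bullet> x)) * DIM('a)
    - (B1 (x \<bullet> x) * (real DIM('a) + 4) + 2 * B2 (x \<bullet> x) * (x \<bullet> x)) * (2 * (x \<bullet> x))"
    unfolding scal_def Ric
    by (simp add: sum_subtractf trace_g[OF x C] trace_theta[OF x C] flip: sum_distrib_left)
qed

section \<open>The Bochner tensor and its vanishing\<close>

lemma bochner_eq:
  assumes x: "x \<in> U" and T10: "A \<in> T10 J x" "B' \<in> T10 J x" "C \<in> T10 J x" "E \<in> T10 J x"
  defines "n \<equiv> of_nat DIM('a) / 2 :: complex" and "r \<equiv> complex_of_real (x \<bullet> x)"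
    and "G \<equiv> cext2 (g x)" and "\<Theta> \<equiv> cext2 (theta x)"
  shows "bochner g x A (conj_vec B') C (conj_vec E) = - 2 * complex_of_real (B2 (x \<bullet> x)) *
    (\<Theta> A (conj_vec B') * \<Theta> C (conj_vec E)
     - r / (n + 2) * (G A (conj_vec B') * \<Theta> C (conj_vec E) + G C (conj_vec B') * \<Theta> A (conj_vec E)
         + G C (conj_vec E) * \<Theta> A (conj_vec B') + G A (conj_vec E) * \<Theta> C (conj_vec B'))
     + r\<^sup>2 / ((n + 1) * (n + 2)) * (G A (conj_vec B') * G C (conj_vec E) + G C (conj_vec B') * G A (conj_vec E)))"
proof -
  define b b1 b2 where "b = complex_of_real (B (x \<bullet> x))" "b1 = complex_of_real (B1 (x \<bullet> x))"
    "b2 = complex_of_real (B2 (x \<bullet> x))"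
  have hg: "hermitian_pair J x (g x) om"
  proof -
    have om: "om u (J x v) = g x u v" "om (- u) v = - om u v" for u v
      using g_J_J[OF x, of u v] by (simp_all add: g_J[OF x] om_def j.neg)
    show ?thesis
      unfolding hermitian_pair_def g_J[OF x] om g_minus_left[OF x]
      by (auto simp: g_sym[OF x])
  qed
  have ht: "hermitian_pair J x (theta x) (nu x)"
    by (simp add: hermitian_pair_def theta_J[OF x] nu_J[OF x]) (simp add: theta_def nu_def)
  have n: "n + 1 \<noteq> 0" "n + 2 \<noteq> 0" "complex_of_real (real DIM('a)) = 2 * n"
  proof -
    show "n + 1 \<noteq> 0" "n + 2 \<noteq> 0"
      by (simp_all add: n_def complex_eq_iff add_nonneg_eq_0_iff)
  qed (simp add: n_def)
  have R: "cext4 (Riem g x) A (conj_vec B') C (conj_vec E) =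
    - 2 * b * (G C (conj_vec B') * G A (conj_vec E) + G A (conj_vec B') * G C (conj_vec E))
    - 2 * b1 * (G C (conj_vec B') * \<Theta> A (conj_vec E) + G A (conj_vec B') * \<Theta> C (conj_vec E)
       + \<Theta> C (conj_vec B') * G A (conj_vec E) + \<Theta> A (conj_vec B') * G C (conj_vec E))
    - 2 * b2 * (\<Theta> A (conj_vec B') * \<Theta> C (conj_vec E))"
    unfolding Riem_eq[OF x, abs_def] cext4_linear cext4_kulkarni_T10[OF hg hg T10] cext4_kulkarni_T10[OF hg ht T10]
      cext4_kulkarni_T10[OF ht hg T10] cext4_prod hermitian_pair_om[OF ht T10(1)] hermitian_pair_om[OF ht T10(3)]
    by (simp add: b_b1_b2_def G_def \<Theta>_def algebra_simps)
  \<comment> \<open>The coefficients in Ric = - a g - c theta. Since the traces of \<open>g\<close>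
    and \<open>theta\<close> are \<open>2 * n\<close> and \<open>2 * r\<close>, they also determine
    the scalar curvature.\<close>
  define a c where "a = B (x \<bullet> x) * (real DIM('a) + 2) + 2 * B1 (x \<bullet> x) * (x \<bullet> x)"
    "c = B1 (x \<bullet> x) * (real DIM('a) + 4) + 2 * B2 (x \<bullet> x) * (x \<bullet> x)"
  have "Ric g x = (\<lambda>y z. - a * g x y z - c * theta x y z)"
    by (intro ext) (simp only: Ric_eq[OF x] a_c_def)
  then have Ric: "cext2 (Ric g x) V W = - of_real a * G V W - of_real c * \<Theta> V W" for V W
    by (simp add: G_def \<Theta>_def cext2_def cext_def algebra_simps)
  have ac: "complex_of_real a = b * (2 * n + 2) + 2 * b1 * r"
    "complex_of_real c = b1 * (2 * n + 4) + 2 * b2 * r"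
    "complex_of_real (scal g x) = - (of_real a * (2 * n)) - of_real c * (2 * r)"
    by (simp_all add: scal_eq[OF x] a_c_def b_b1_b2_def r_def n(3)[symmetric]) (simp add: algebra_simps)
  show ?thesis
    unfolding bochner_def Let_def n_def[symmetric] G_def[symmetric] R Ric ac b_b1_b2_def(3)[symmetric]
    by (rule bochner_alg[OF n(1,2)])
qed

lemma bochner_zero_iff:
  assumes dim: "DIM('a) \<ge> 3" and x: "x \<in> U"
  shows "(\<forall>A\<in>T10 J x. \<forall>B\<in>T10 J x. \<forall>C\<in>T10 J x. \<forall>E\<in>T10 J x.
      bochner g x A (conj_vec B) C (conj_vec E) = 0) \<longleftrightarrow> B2 (x \<bullet> x) = 0" (is "?L \<longleftrightarrow> _")
proof
  assume "B2 (x \<bullet> x) = 0"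
  then show ?L by (simp add: bochner_eq[OF x])
next
  assume L: ?L
  \<comment> \<open>On a vector orthogonal to the complex line of \<open>x\<close> all terms with \<open>theta\<close> vanish.\<close>
  have "dim {x, j x} < DIM('a)"
    using dim_le_card'[of "{x, j x}"] card_insert_le_m1[of 2 "{j x}" x] dim by simp
  then obtain v where v: "v \<noteq> 0" and "\<And>y. y \<in> span {x, j x} \<Longrightarrow> orthogonal v y"
    using orthogonal_to_subspace_exists by metis
  then have o: "x \<bullet> v = 0" "j x \<bullet> v = 0"
    by (simp_all add: orthogonal_def span_base inner_commute[of _ v])
  have Jv: "J x v = j v" and o': "x \<bullet> j v = 0" "j x \<bullet> j v = 0"
    by (simp_all add: J_U[OF x] o j_adj[of x] j_isometry)
  \<comment> \<open>On the complement of \<open>x\<close> and \<open>j x\<close> the structure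
    \<open>J\<close> acts as \<open>j\<close>, so this is the (1,0) vector v - i Jv.\<close>
  define V where "V = (v, - j v)"
  have V: "V \<in> T10 J x"
    using J_J[OF x, of v] by (simp add: T10_def V_def Jv linear_neg[OF linear_J[OF x]])
  have \<Theta>: "cext2 (theta x) V W = 0" for W
    by (simp add: V_def cext2_def cext_def theta_def o o')
  have G: "cext2 (g x) V (conj_vec V) = complex_of_real (2 * (v \<bullet> v))"
    by (simp add: V_def cext2_def cext_def conj_vec_def g_U[OF x] o o' j_isometry j_adj[of v v])
  have n: "of_nat DIM('a) / 2 + 1 \<noteq> (0::complex)" "of_nat DIM('a) / 2 + 2 \<noteq> (0::complex)"
    by (simp_all add: complex_eq_iff add_nonneg_eq_0_iff)
  \<comment> \<open>With all arguments built from \<open>V\<close>, only the last term of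
    \<open>bochner_eq\<close> survives: a nonzero multiple of \<open>B2\<close>.\<close>
  from L V have "bochner g x V (conj_vec V) V (conj_vec V) = 0" by blast
  then have "complex_of_real (B2 (x \<bullet> x)) = 0"
    using n v sq_pos[OF x] unfolding bochner_eq[OF x V V V V] \<Theta> G by simp
  then show "B2 (x \<bullet> x) = 0" by simp
qed

text \<open>\<open>g\<close> and \<open>J\<close> are built from the profile, linear maps and
  division by the positive function \<open>P\<close>, so their smoothness follows from that of the
  profile.\<close>

lemma kahler:
  assumes "smooth_on U (\<lambda>x. B (x \<bullet> x))"
  shows "kahler_on U g J"
proof -
  note sm = smooth_intros[OF open_U] smooth_on_bounded_linear[OF open_U bounded_linear_j] assms
  have P: "P (x \<bullet> x) = 1 + (x \<bullet> x) * B (x \<bullet> x)" for x by (simp add: P_def)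
  have "smooth_on U (\<lambda>x. g x u v)" for u v
    by (rule smooth_on_cong[OF open_U g_U[symmetric]], assumption, unfold P)
      (intro sm; use P_ne[unfolded P] in simp)
  moreover have "smooth_on U (\<lambda>x. J x u)" for u
    by (rule smooth_on_cong[OF open_U J_U[symmetric]], assumption, unfold P)
      (intro sm; use P_ne[unfolded P] in simp)
  ultimately show ?thesis
    unfolding kahler_on_def riemannian_on_def
    using open_U bilinear_g g_sym g_pos linear_J J_J g_J_J nabla_J by blast
qed

end

section \<open>The type I hypersurface in its chart\<close>

lemma linear_J0: "linear (J0 :: complex ^ 'n::finite \<Rightarrow> complex ^ 'n)"
  by (intro linearI) (simp_all add: J0_def vec_eq_iff algebra_simps scaleR_conv_of_real)

lemma J0_J0: "J0 (J0 u) = - (u :: complex ^ 'n::finite)"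
  by (simp add: J0_def vec_eq_iff)

lemma J0_inner: "J0 u \<bullet> J0 v = u \<bullet> (v :: complex ^ 'n::finite)"
  by (simp add: J0_def inner_vec_def inner_complex_def add.commute)

section \<open>The inverse function of the meridian\<close>

lemma
  assumes "type_I_meridian I t q"
  shows type_I_open: "open I"
    and type_I_DERIV_t: "s \<in> I \<Longrightarrow> (t has_real_derivative deriv t s) (at s)"
    and type_I_DERIV_q: "s \<in> I \<Longrightarrow> (q has_real_derivative deriv q s) (at s)"
    and type_I_arclength: "s \<in> I \<Longrightarrow> (deriv t s)\<^sup>2 + (deriv q s)\<^sup>2 = 1"
    and type_I_image_pos: "r \<in> t ` I \<Longrightarrow> 0 < r" and type_I_t'_pos: "s \<in> I \<Longrightarrow> 0 < deriv t s"
    and type_I_open_image: "open (t ` I)"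
    and type_I_interval_image: "is_interval (t ` I)"
    and type_I_s_of: "r \<in> t ` I \<Longrightarrow> s_of I t r \<in> I" "r \<in> t ` I \<Longrightarrow> t (s_of I t r) = r"
    and type_I_DERIV_s_of: "r \<in> t ` I \<Longrightarrow>
      (s_of I t has_real_derivative inverse (deriv t (s_of I t r))) (at r)"
proof -
  have I: "open I" "is_interval I" "smooth_on I t" "smooth_on I q"
    using assms by (auto simp: type_I_meridian_def)
  show "open I" by fact
  show D: "(t has_real_derivative deriv t s) (at s)" if "s \<in> I" for s
    using smooth_on_real(1)[OF I(1,3) that] .
  show "(q has_real_derivative deriv q s) (at s)" if "s \<in> I" for s
    using smooth_on_real(1)[OF I(1,4) that] .
  have pos: "0 < deriv t s" if "s \<in> I" for s
    using assms that by (auto simp: type_I_meridian_def)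
  then show "s \<in> I \<Longrightarrow> 0 < deriv t s" by blast
  show "s \<in> I \<Longrightarrow> (deriv t s)\<^sup>2 + (deriv q s)\<^sup>2 = 1" "r \<in> t ` I \<Longrightarrow> 0 < r"
    using assms by (auto simp: type_I_meridian_def)
  have less: "t a < t b" if "a \<in> I" "b \<in> I" "a < b" for a b
    by (rule DERIV_pos_imp_increasing[OF \<open>a < b\<close>])
      (use D pos I(2) that in \<open>meson mem_is_interval_1_I\<close>)
  have inj: "inj_on t I"
    by (rule linorder_inj_onI) (use less in \<open>force\<close>)+
  have cont: "continuous_on I t"
    by (intro continuous_at_imp_continuous_on ballI DERIV_isCont[OF D])
  show "open (t ` I)" by (rule invariance_of_domain[OF cont I(1) inj])
  show "is_interval (t ` I)"
    using connected_continuous_image[OF cont] I(2) by (simp add: is_interval_connected_1)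
  show s: "s_of I t r \<in> I" "t (s_of I t r) = r" if "r \<in> t ` I" for r
    using that inj by (auto simp: s_of_def the_inv_into_f_f)
  show "(s_of I t has_real_derivative inverse (deriv t (s_of I t r))) (at r)" if r: "r \<in> t ` I"
  proof -
    have "(s_of I t has_derivative (*) (inverse (deriv t (s_of I t r)))) (at (t (s_of I t r)))"
    proof (rule has_derivative_inverse_strong[OF I(1) s(1)[OF r] cont])
      show "s_of I t (t s) = s" if "s \<in> I" for s
        using that inj by (simp add: s_of_def the_inv_into_f_f)
      show "(t has_derivative (*) (deriv t (s_of I t r))) (at (s_of I t r))"
        using D[OF s(1)[OF r]] by (simp add: has_field_derivative_def)
      show "(*) (deriv t (s_of I t r)) \<circ> (*) (inverse (deriv t (s_of I t r))) = id"
        using pos[OF s(1)[OF r]] by (auto simp: fun_eq_iff)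
    qed
    then show ?thesis by (simp add: s(2)[OF r] has_field_derivative_def)
  qed
qed

definition slope :: "real set \<Rightarrow> (real \<Rightarrow> real) \<Rightarrow> real \<Rightarrow> real" where
  "slope I t r = deriv t (s_of I t r)"

definition sq_domain :: "real set \<Rightarrow> (real \<Rightarrow> real) \<Rightarrow> real set" where
  "sq_domain I t = {r. 0 < r \<and> sqrt r \<in> t ` I}"

text \<open>The function \<open>B\<close> of the overview in the variable
  \<open>x \<bullet> x\<close>, whence the \<open>sqrt\<close>; for \<open>r > 0\<close> it makes
  \<open>1 + r * B r\<close> equal to \<open>t'\<close> at radius \<open>sqrt r\<close>.\<close>

definition profile :: "real set \<Rightarrow> (real \<Rightarrow> real) \<Rightarrow> real \<Rightarrow> real" where
  "profile I t r = (slope I t (sqrt r) - 1) / r"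

lemma inner_mem_sq_domain:
  assumes "type_I_meridian I t q"
  shows "x \<bullet> x \<in> sq_domain I t \<longleftrightarrow> norm x \<in> t ` I"
  using type_I_image_pos[OF assms, of "norm x"] by (auto simp: sq_domain_def norm_eq_sqrt_inner)

lemma chart_dom_eq:
  assumes "type_I_meridian I t q"
  shows "chart_dom I t q = {x :: complex ^ 'n::finite. norm x \<in> t ` I}"
proof (intro set_eqI iffI)
  fix x :: "complex ^ 'n"
  assume "x \<in> chart_dom I t q"
  then obtain s n where "s \<in> I" "norm n = 1" "x = t s *\<^sub>R n"
    by (auto simp: chart_dom_def rot_hypersurface_def rot_point_def)
  then show "x \<in> {x. norm x \<in> t ` I}"
    using type_I_image_pos[OF assms, of "t s"] by simp
next
  fix x :: "complex ^ 'n"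
  assume "x \<in> {x. norm x \<in> t ` I}"
  then obtain s where s: "s \<in> I" "norm x = t s" by auto
  then have "x \<noteq> 0" using type_I_image_pos[OF assms, of "t s"] by auto
  then have "x = fst (rot_point t q s (sgn x))" "sgn x \<in> sphere 0 1"
    by (simp_all add: rot_point_def s(2)[symmetric] sgn_div_norm norm_sgn)
  then show "x \<in> chart_dom I t q"
    unfolding chart_dom_def rot_hypersurface_def using s(1) by blast
qed

section \<open>The metric and the complex structure in the chart\<close>

context
  fixes I t q and x :: "complex ^ 'n::finite"
  assumes typeI: "type_I_meridian I t q" and x: "norm x \<in> t ` I"
begin

lemma norm_x: "x \<noteq> 0" "0 < norm x"
  using type_I_image_pos[OF typeI x] by simp_all

lemma slope_pos: "0 < slope I t (norm x)"
  using type_I_t'_pos[OF typeI type_I_s_of(1)[OF typeI x]] by (simp add: slope_def)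

lemma Dir_graph_map:
  "Dir (graph_map I t q) x u =
    (u, deriv q (s_of I t (norm x)) / slope I t (norm x) * (sgn x \<bullet> u))"
proof -
  let ?s = "s_of I t (norm x)"
  have "((\<lambda>r. q (s_of I t r)) has_real_derivative deriv q ?s * inverse (deriv t ?s)) (at (norm x))"
    by (rule DERIV_chain2[OF type_I_DERIV_q[OF typeI type_I_s_of(1)[OF typeI x]]
          type_I_DERIV_s_of[OF typeI x]])
  then have "((\<lambda>r. q (s_of I t r)) has_derivative (\<lambda>h. deriv q ?s * inverse (deriv t ?s) * h)) (at (norm x))"
    by (simp add: has_field_derivative_def)
  from has_derivative_compose[OF has_derivative_norm[OF norm_x(1)] this]
  have "(graph_map I t q has_derivative
      (\<lambda>u. (u, deriv q ?s * inverse (deriv t ?s) * (u \<bullet> sgn x)))) (at x)"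
    unfolding graph_map_def[abs_def] by (intro has_derivative_Pair has_derivative_ident)
  from frechet_derivative_at[OF this] show ?thesis
    by (simp add: fun_eq_iff slope_def divide_inverse inner_commute)
qed

lemma xi_graph_map:
  "xi I t q (graph_map I t q x) = (slope I t (norm x) *\<^sub>R sgn x, deriv q (s_of I t (norm x)))"
proof -
  let ?s = "s_of I t (norm x)"
  note s = type_I_s_of(1)[OF typeI x]
  have "((\<lambda>s. rot_point t q s (sgn x)) has_vector_derivative
      (deriv t ?s *\<^sub>R sgn x, deriv q ?s)) (at ?s)"
    unfolding rot_point_def
    using type_I_DERIV_t[OF typeI s] type_I_DERIV_q[OF typeI s]
    by (auto intro!: has_vector_derivative_Pair derivative_eq_intros
        simp: has_real_derivative_iff_has_vector_derivative)
  then show ?thesis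
    by (simp add: xi_def s_at_def n_at_def graph_map_def slope_def vector_derivative_at)
qed

text \<open>With \<open>p = t'\<close>, the axial component contributes \<open>q'^2 / p\<close>, and
  the arc length condition turns \<open>p + q'^2 / p\<close> into \<open>1 / p\<close>.\<close>

lemma eta_graph_map:
  "eta I t q (graph_map I t q x) (Dir (graph_map I t q) x u) = (sgn x \<bullet> u) / slope I t (norm x)"
  "eta_tilde (graph_map I t q x) (Dir (graph_map I t q) x u) = J0 (sgn x) \<bullet> u"
proof -
  define p q' where "p = slope I t (norm x)" "q' = deriv q (s_of I t (norm x))"
  have q: "q' * q' = 1 - p * p"
    using type_I_arclength[OF typeI type_I_s_of(1)[OF typeI x]]
    by (simp add: p_q'_def slope_def power2_eq_square algebra_simps)
  have "eta I t q (graph_map I t q x) (Dir (graph_map I t q) x u) = (sgn x \<bullet> u) * (p + q' * q' / p)"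
    by (simp add: eta_def xi_graph_map Dir_graph_map inner_Pair p_q'_def algebra_simps)
  then show "eta I t q (graph_map I t q x) (Dir (graph_map I t q) x u) = (sgn x \<bullet> u) / slope I t (norm x)"
    using slope_pos unfolding q p_q'_def(1)[symmetric] by (simp add: field_simps)
  show "eta_tilde (graph_map I t q x) (Dir (graph_map I t q) x u) = J0 (sgn x) \<bullet> u"
    by (simp add: eta_tilde_def xi_tilde_def n_at_def graph_map_def[of I t q x] Dir_graph_map inner_Pair)
qed

lemma
  shows profile_norm: "profile I t (x \<bullet> x) = (slope I t (norm x) - 1) / (norm x)\<^sup>2"
    and one_plus_profile: "1 + x \<bullet> x * profile I t (x \<bullet> x) = slope I t (norm x)"
    and sgn_norm: "sgn x = (1 / norm x) *\<^sub>R x" and J0_sgn: "J0 (sgn x) = (1 / norm x) *\<^sub>R J0 x"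
proof -
  show 1: "profile I t (x \<bullet> x) = (slope I t (norm x) - 1) / (norm x)\<^sup>2"
    by (simp add: profile_def flip: norm_eq_sqrt_inner power2_norm_eq_inner)
  show "1 + x \<bullet> x * profile I t (x \<bullet> x) = slope I t (norm x)"
    unfolding 1 using norm_x by (simp flip: power2_norm_eq_inner)
  show "sgn x = (1 / norm x) *\<^sub>R x"
    by (simp add: sgn_div_norm divide_inverse)
  then show "J0 (sgn x) = (1 / norm x) *\<^sub>R J0 x"
    using linear_scale[OF linear_J0] by simp
qed

lemma g_chart_eq: "g_chart I t q x u v =
        u \<bullet> v - profile I t (x \<bullet> x) / (1 + x \<bullet> x * profile I t (x \<bullet> x)) * (x \<bullet> u) * (x \<bullet> v)
        + profile I t (x \<bullet> x) * (J0 x \<bullet> u) * (J0 x \<bullet> v)"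
proof -
  define p r q' where "p = slope I t (norm x)" "r = norm x" "q' = deriv q (s_of I t (norm x))"
  have p: "p > 0" and r: "r > 0" using slope_pos norm_x by (auto simp: p_r_q'_def)
  have q: "q' * q' = 1 - p * p"
    using type_I_arclength[OF typeI type_I_s_of(1)[OF typeI x]]
    by (simp add: p_r_q'_def slope_def power2_eq_square algebra_simps)
  have "g_chart I t q x u v = u \<bullet> v + q' * q' / (p * p) * (sgn x \<bullet> u) * (sgn x \<bullet> v)
     + (p - 1) * ((sgn x \<bullet> u) / p * ((sgn x \<bullet> v) / p) + (J0 (sgn x) \<bullet> u) * (J0 (sgn x) \<bullet> v))"
    unfolding g_chart_def g_M_def eta_graph_map unfolding Dir_graph_map
    by (simp add: s_at_def graph_map_def inner_Pair p_r_q'_def slope_def[of I t] mult.assoc)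
  \<comment> \<open>By the arc length condition the radial coefficient is
    \<open>(1 - p^2) / p^2 + (p - 1) / p^2 = (1 - p) / p\<close>, so \<open>q\<close>
    disappears.\<close>
  also have "\<dots> = u \<bullet> v + (1 - p) / p / (r * r) * (x \<bullet> u) * (x \<bullet> v) + (p - 1) / (r * r) * (J0 x \<bullet> u) * (J0 x \<bullet> v)"
    using p r unfolding q J0_sgn unfolding sgn_norm p_r_q'_def(2)[symmetric]
    by (simp add: field_simps)
  finally show ?thesis
    unfolding one_plus_profile unfolding profile_norm p_r_q'_def(1)[symmetric] unfolding p_r_q'_def(2)[symmetric] using p r
    by (simp add: field_simps power2_eq_square)
qed

text \<open>The structure sends \<open>sgn x\<close> to \<open>J0 (sgn x)\<close> divided by
  \<open>p\<close>, and \<open>J0 (sgn x)\<close> to \<open>- p\<close> times \<open>sgn x\<close>;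
  on the complement of this plane it is \<open>J0\<close>.\<close>

lemma J_chart_eq: "J_chart I t q x u =
        J0 u - (profile I t (x \<bullet> x) / (1 + x \<bullet> x * profile I t (x \<bullet> x)) * (x \<bullet> u)) *\<^sub>R J0 x
        - (profile I t (x \<bullet> x) * (J0 x \<bullet> u)) *\<^sub>R x"
proof -
  define p r where "p = slope I t (norm x)" "r = norm x"
  have p: "p > 0" and r: "r > 0" using slope_pos norm_x by (auto simp: p_r_def)
  interpret J0: linear "J0 :: complex ^ 'n \<Rightarrow> complex ^ 'n" by (rule linear_J0)
  have "J_chart I t q x u = ((sgn x \<bullet> u) / p) *\<^sub>R J0 (sgn x) - ((J0 (sgn x) \<bullet> u) * p) *\<^sub>R sgn x
     + J0 (u - ((sgn x \<bullet> u) / p * p) *\<^sub>R sgn x - (J0 (sgn x) \<bullet> u) *\<^sub>R J0 (sgn x))"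
    unfolding J_chart_def J_M_def D_part_def eta_graph_map xi_graph_map
    by (simp add: Dir_graph_map xi_tilde_def n_at_def graph_map_def[of I t q x] p_r_def)
  also have "\<dots> = J0 u + ((1 / p - 1) / (r * r) * (x \<bullet> u)) *\<^sub>R J0 x - ((p - 1) / (r * r) * (J0 x \<bullet> u)) *\<^sub>R x"
    using p unfolding J0_sgn unfolding sgn_norm p_r_def(2)[symmetric]
    by (simp add: J0.add J0.diff J0.scaleR J0_J0 diff_divide_distrib algebra_simps)
  also have "(1 / p - 1) / (r * r) * (x \<bullet> u) = - ((p - 1) / r\<^sup>2 / p * (x \<bullet> u))"
    using p r by (simp add: field_simps power2_eq_square)
  finally show ?thesis
    unfolding one_plus_profile unfolding profile_norm p_r_def(1)[symmetric] unfolding p_r_def(2)[symmetric]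
    by (simp add: power2_eq_square)
qed

end

section \<open>Domain and differentiability of the profile\<close>

lemma open_sq_domain:
  assumes "type_I_meridian I t q"
  shows "open (sq_domain I t)"
proof -
  have "sq_domain I t = {0<..} \<inter> sqrt -` (t ` I)" by (auto simp: sq_domain_def)
  moreover have "open (sqrt -` (t ` I))"
    by (intro open_vimage type_I_open_image[OF assms] continuous_intros)
  ultimately show ?thesis by auto
qed

text \<open>The squares of an interval of positive numbers form a connected set; convexity lets a
  vanishing derivative imply constancy.\<close>

lemma convex_sq_domain:
  assumes "type_I_meridian I t q"
  shows "convex (sq_domain I t)"
proof -
  have "sq_domain I t = (\<lambda>r. r\<^sup>2) ` t ` I"
  proof (intro set_eqI iffI)
    fix r assume "r \<in> sq_domain I t"
    then show "r \<in> (\<lambda>r. r\<^sup>2) ` t ` I"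
      by (intro image_eqI[of r _ "sqrt r"]) (auto simp: sq_domain_def)
  next
    fix r assume "r \<in> (\<lambda>r. r\<^sup>2) ` t ` I"
    then show "r \<in> sq_domain I t"
      using type_I_image_pos[OF assms] by (force simp: sq_domain_def)
  qed
  moreover have "connected (t ` I)"
    using type_I_interval_image[OF assms] by (simp add: is_interval_connected_1)
  ultimately have "connected (sq_domain I t)"
    by (auto intro!: connected_continuous_image continuous_intros)
  then show ?thesis by (simp add: is_interval_connected_1 flip: is_interval_convex_1)
qed

lemma profile_derivatives:
  assumes M: "type_I_meridian I t q"
  obtains B1 B2 where
    "\<And>r. r \<in> sq_domain I t \<Longrightarrow> (profile I t has_real_derivative B1 r) (at r)"
    "\<And>r. r \<in> sq_domain I t \<Longrightarrow> (B1 has_real_derivative B2 r) (at r)"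
proof -
  note I = type_I_open[OF M]
  have t: "smooth_on I t" using M by (simp add: type_I_meridian_def)
  note t1 = smooth_on_real(2)[OF I t]
  note t2 = smooth_on_real(2)[OF I t1]
  \<comment> \<open>The derivative of \<open>slope\<close> is \<open>t'' / t'\<close>, because the
    inverse function has the derivative \<open>1 / t'\<close>.\<close>
  define p1 where "p1 r = deriv (deriv t) (s_of I t r) / deriv t (s_of I t r)" for r
  have D1: "(slope I t has_real_derivative p1 r) (at r)" if r: "r \<in> t ` I" for r
    using DERIV_chain2[OF smooth_on_real(1)[OF I t1 type_I_s_of(1)[OF M r]] type_I_DERIV_s_of[OF M r]]
    by (simp add: slope_def[abs_def] p1_def divide_inverse)
  have D2: "\<exists>d. (p1 has_real_derivative d) (at r)" if r: "r \<in> t ` I" for r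
  proof -
    note s = type_I_s_of(1)[OF M r]
    have "deriv t (s_of I t r) \<noteq> 0" using type_I_t'_pos[OF M s] by simp
    from DERIV_divide[OF DERIV_chain2[OF smooth_on_real(1)[OF I t2 s] type_I_DERIV_s_of[OF M r]]
        DERIV_chain2[OF smooth_on_real(1)[OF I t1 s] type_I_DERIV_s_of[OF M r]] this]
    show ?thesis unfolding p1_def[abs_def] by blast
  qed
  define B1 where "B1 r = (p1 (sqrt r) * (inverse (sqrt r) / 2) * r - (slope I t (sqrt r) - 1)) / (r * r)" for r
  have B1: "(profile I t has_real_derivative B1 r) (at r)" if "r \<in> sq_domain I t" for r
  proof -
    have r: "0 < r" "sqrt r \<in> t ` I" using that by (auto simp: sq_domain_def)
    have "((\<lambda>r. slope I t (sqrt r)) has_real_derivative p1 (sqrt r) * (inverse (sqrt r) / 2)) (at r)"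
      by (rule DERIV_chain2[OF D1[OF r(2)] DERIV_real_sqrt[OF r(1)]])
    then show ?thesis
      unfolding profile_def[abs_def] B1_def using r(1)
      by (auto intro!: derivative_eq_intros)
  qed
  \<comment> \<open>For the second derivative existence is enough; \<open>deriv\<close> then names
    it.\<close>
  have B2: "\<exists>d. (B1 has_real_derivative d) (at r)" if "r \<in> sq_domain I t" for r
  proof -
    have r: "0 < r" "sqrt r \<in> t ` I" using that by (auto simp: sq_domain_def)
    obtain d where "(p1 has_real_derivative d) (at (sqrt r))" using D2[OF r(2)] by blast
    note D = DERIV_chain2[OF this DERIV_real_sqrt[OF r(1)]] DERIV_chain2[OF D1[OF r(2)] DERIV_real_sqrt[OF r(1)]]
    show ?thesis
      unfolding B1_def[abs_def] using r(1)
      by (intro exI) (rule derivative_eq_intros D DERIV_real_sqrt refl | simp)+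
  qed
  show thesis
    by (rule that[of B1 "\<lambda>r. deriv B1 r"]) (use B1 B2 DERIV_imp_deriv in \<open>blast, metis\<close>)
qed

section \<open>From the vanishing of the second derivative of the profile to the integral formula
  and back\<close>

theorem proposition6p3:
  fixes I :: "real set" and t q :: "real \<Rightarrow> real"
  assumes "CARD('n::finite) \<ge> 2"
    and "type_I_meridian I t q"
  shows "bochner_kahler_on (chart_dom I t q :: (complex ^ 'n) set) (g_chart I t q) (J_chart I t q)
    \<longleftrightarrow> (\<exists>c1 c2 :: real. \<forall>r \<in> t ` I.
          c1 * r ^ 4 + c2 * r ^ 2 + 1 \<noteq> 0 \<and>
          (s_of I t has_real_derivative 1 / (c1 * r ^ 4 + c2 * r ^ 2 + 1)) (at r))"
proof -
  note M = assms(2)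
  let ?T = "sq_domain I t" and ?B = "profile I t"
  obtain B1 B2 where B: "\<And>r. r \<in> ?T \<Longrightarrow> (?B has_real_derivative B1 r) (at r)"
    "\<And>r. r \<in> ?T \<Longrightarrow> (B1 has_real_derivative B2 r) (at r)"
    using profile_derivatives[OF M] by blast
  have slope: "0 < slope I t r" "slope I t r = 1 + r\<^sup>2 * ?B (r\<^sup>2)" "r\<^sup>2 \<in> ?T" if "r \<in> t ` I" for r
    using that type_I_t'_pos[OF M type_I_s_of(1)[OF M that]] type_I_image_pos[OF M that]
    by (simp_all add: slope_def profile_def sq_domain_def)
  have T: "r \<in> ?T \<Longrightarrow> \<exists>r'\<in>t ` I. r = r'\<^sup>2" for r
    by (intro bexI[of _ "sqrt r"]) (auto simp: sq_domain_def)
  interpret rotational_metric "J0 :: complex ^ 'n \<Rightarrow> complex ^ 'n" ?T ?B B1 B2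
    "g_chart I t q" "J_chart I t q"
  proof
    show "0 < r" if "r \<in> ?T" for r
      using that by (simp add: sq_domain_def)
    show "0 < 1 + r * ?B r" if "r \<in> ?T" for r
      using T[OF that] slope by force
  qed (auto simp: J0_J0 J0_inner linear_J0 open_sq_domain[OF M] B g_chart_eq[OF M] J_chart_eq[OF M]
      inner_mem_sq_domain[OF M] linear_add[OF linear_J0] linear_scale[OF linear_J0])
  have U: "U = chart_dom I t q"
    by (simp add: U_def chart_dom_eq[OF M] inner_mem_sq_domain[OF M])
  let ?Z = "\<lambda>p. \<forall>A\<in>T10 (J_chart I t q) p. \<forall>B\<in>T10 (J_chart I t q) p.
    \<forall>C\<in>T10 (J_chart I t q) p. \<forall>E\<in>T10 (J_chart I t q) p.
      bochner (g_chart I t q) p A (conj_vec B) C (conj_vec E) = 0"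
  \<comment> \<open>The real dimension is \<open>2 * CARD('n)\<close>, hence at least 4.\<close>
  have "DIM(complex ^ 'n) \<ge> 3" using assms(1) by simp
  note zero_iff = bochner_zero_iff[OF this]
  \<comment> \<open>Every squared radius is attained, so a condition on
    \<open>B2 (x \<bullet> x)\<close> over the chart is one on \<open>B2\<close> over
    \<open>?T\<close>.\<close>
  have U_sq: "\<exists>x\<in>U. x \<bullet> x = r" if "r \<in> ?T" for r
  proof -
    obtain b :: "complex ^ 'n" where "b \<in> Basis" using nonempty_Basis by blast
    then have r: "(sqrt r *\<^sub>R b) \<bullet> (sqrt r *\<^sub>R b) = r"
      using T_pos[OF that] by (simp add: inner_Basis)
    moreover have "sqrt r *\<^sub>R b \<in> U"
      unfolding U_def mem_Collect_eq r by (rule that)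
    ultimately show ?thesis by blast
  qed
  show ?thesis
  proof
    assume "bochner_kahler_on (chart_dom I t q :: (complex ^ 'n) set) (g_chart I t q) (J_chart I t q)"
    then have "\<forall>p\<in>U. ?Z p"
      unfolding bochner_kahler_on_def U by (rule conjunct2)
    then have "B2 (x \<bullet> x) = 0" if "x \<in> U" for x
      unfolding zero_iff[OF that, symmetric] using that by (rule bspec)
    then have B2: "B2 r = 0" if "r \<in> ?T" for r using U_sq[OF that] by blast
    \<comment> \<open>The equation \<open>B'' = 0\<close> is integrated twice on the convex domain;
      \<open>c1\<close> and \<open>c2\<close> are the constants of integration.\<close>
    have "(B1 has_real_derivative 0) (at r within ?T)" if "r \<in> ?T" for r
      using has_field_derivative_at_within[OF B(2)[OF that]] by (simp add: B2[OF that])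
    then have "\<exists>c. \<forall>r\<in>?T. B1 r = c"
      by (rule has_field_derivative_zero_constant[OF convex_sq_domain[OF M]])
    then obtain c1 where c1: "\<And>r. r \<in> ?T \<Longrightarrow> B1 r = c1" by blast
    have "((\<lambda>r. ?B r - c1 * r) has_real_derivative 0) (at r within ?T)" if "r \<in> ?T" for r
      using has_field_derivative_at_within[OF DERIV_diff[OF B(1)[OF that] DERIV_cmult_Id[of c1]]]
      by (simp add: c1[OF that])
    then have "\<exists>c. \<forall>r\<in>?T. ?B r - c1 * r = c"
      by (rule has_field_derivative_zero_constant[OF convex_sq_domain[OF M]])
    then obtain c2 where c2: "\<And>r. r \<in> ?T \<Longrightarrow> ?B r - c1 * r = c2" by blast
    \<comment> \<open>Inserting the affine profile into t' = 1 + r^2 B(r^2) produces the even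
      quartic.\<close>
    have p: "slope I t r = c1 * r ^ 4 + c2 * r ^ 2 + 1" if "r \<in> t ` I" for r
      unfolding slope(2)[OF that] c2[OF slope(3)[OF that], symmetric]
      by (simp add: algebra_simps power2_eq_square power4_eq_xxxx)
    show "\<exists>c1 c2. \<forall>r\<in>t ` I. c1 * r ^ 4 + c2 * r ^ 2 + 1 \<noteq> 0 \<and>
          (s_of I t has_real_derivative 1 / (c1 * r ^ 4 + c2 * r ^ 2 + 1)) (at r)"
    proof (intro exI ballI)
      fix r assume r: "r \<in> t ` I"
      show "c1 * r ^ 4 + c2 * r ^ 2 + 1 \<noteq> 0 \<and>
          (s_of I t has_real_derivative 1 / (c1 * r ^ 4 + c2 * r ^ 2 + 1)) (at r)"
        using slope(1)[OF r] type_I_DERIV_s_of[OF M r] unfolding p[OF r, symmetric]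
        by (simp add: slope_def inverse_eq_divide)
    qed
  next
    assume "\<exists>c1 c2. \<forall>r\<in>t ` I. c1 * r ^ 4 + c2 * r ^ 2 + 1 \<noteq> 0 \<and>
          (s_of I t has_real_derivative 1 / (c1 * r ^ 4 + c2 * r ^ 2 + 1)) (at r)"
    then obtain c1 c2 where c: "\<And>r. r \<in> t ` I \<Longrightarrow>
        (s_of I t has_real_derivative 1 / (c1 * r ^ 4 + c2 * r ^ 2 + 1)) (at r)" by blast
    \<comment> \<open>The inverse function has the derivative \<open>1 / t'\<close> as well as the
      given one; uniqueness recovers \<open>t'\<close>.\<close>
    have "slope I t r = c1 * r ^ 4 + c2 * r ^ 2 + 1" if "r \<in> t ` I" for r
      using DERIV_unique[OF c[OF that] type_I_DERIV_s_of[OF M that]]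
      by (simp add: slope_def inverse_eq_divide)
    then have *: "r\<^sup>2 * ?B (r\<^sup>2) = r\<^sup>2 * (c1 * r\<^sup>2 + c2)" if "r \<in> t ` I" for r
      using slope(2)[OF that] that by (simp add: algebra_simps power2_eq_square power4_eq_xxxx)
    \<comment> \<open>Cancelling the positive factor \<open>r'^2\<close> shows that the profile is
      affine.\<close>
    have Beq: "?B r = c1 * r + c2" if "r \<in> ?T" for r
    proof -
      from T[OF that] obtain r' where "r' \<in> t ` I" "r = r'\<^sup>2" by blast
      then show ?thesis using *[of r'] T_pos[OF that] by simp
    qed
    \<comment> \<open>\<open>B1\<close> and \<open>B2\<close> are known only as derivatives on
      \<open>?T\<close>, so their values come from uniqueness of the derivative.\<close>
    have B1: "B1 r = c1" if "r \<in> ?T" for r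
    proof (rule DERIV_unique[OF B(1)[OF that]])
      show "(?B has_real_derivative c1) (at r)"
        by (rule has_field_derivative_transform_within_open[OF _ open_T that Beq[symmetric]])
          (auto intro!: derivative_eq_intros)
    qed
    have B2: "B2 r = 0" if "r \<in> ?T" for r
    proof (rule DERIV_unique[OF B(2)[OF that]])
      show "(B1 has_real_derivative 0) (at r)"
        by (rule has_field_derivative_transform_within_open[OF _ open_T that B1[symmetric]]) auto
    qed
    \<comment> \<open>Smoothness of the structure follows because the profile is affine in
      \<open>x \<bullet> x\<close>.\<close>
    have "smooth_on U (\<lambda>x :: complex ^ 'n. ?B (x \<bullet> x))"
      by (rule smooth_on_cong[OF open_U, of "\<lambda>x. c1 * (x \<bullet> x) + c2"])
        (auto simp: Beq U_def intro!: smooth_intros open_U[unfolded U_def])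
    from kahler[OF this]
    show "bochner_kahler_on (chart_dom I t q :: (complex ^ 'n) set) (g_chart I t q) (J_chart I t q)"
      unfolding bochner_kahler_on_def U[symmetric]
    proof
      show "\<forall>p\<in>U. ?Z p"
      proof
        fix p :: "complex ^ 'n"
        assume p: "p \<in> U"
        then have "B2 (p \<bullet> p) = 0" by (intro B2) (simp only: U_def mem_Collect_eq)
        then show "?Z p"
          unfolding zero_iff[OF p] .
      qed
    qed
  qed
qed

end
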